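(* There exists a constant $K$ (independent of $n$, $p$, $\varepsilon$) for which the following holds. Consider the $\mathbb{Z}_2$ Synchronization problem on $n$ nodes with edge probability $p$, noise level $\varepsilon$, and planted vector $z\in\{\pm1\}^n$, where $\varepsilon<\frac12$ and $p(1-2\varepsilon)^2\le\frac12$. If there exists $\delta>0$ (a constant) such that $$(n-1)p\ \ge\ (1+\delta)\,\frac{2}{(1-2\varepsilon)^2}\left[1+\frac{K}{\sqrt{\log n}}+\frac53(1-2\varepsilon)\right]\log n,$$ then, with high probability, the semidefinite program $$\max\ \mathrm{Tr}(YX)\quad\text{s.t. } X\in\mathbb{R}^{n\times n}\text{ symmetric},\ X_{ii}=1 \text{ for all } i,\ X\succeq0$$ achieves exact recovery.
   Context: $\mathbb{Z}_2$ Synchronization: $z\in\{\pm1\}^n$ is fixed; the underlying graph $G$ is an Erdős–Rényi graph on $n$ nodes in which each of the $\binom n2$ edges appears independently with probability $p$. For each edge $(i,j)$ of $G$, independently, the symmetric measurement $Y_{ij}=Y_{ji}$ equals $z_iz_j$ with probability $1-\varepsilon$ and $-z_iz_j$ with probability $\varepsilon$ ($0\le\varepsilon<\frac12$); $Y_{ij}=0$ if $(i,j)$ is not an edge, including $i=j$. "The semidefinite program achieves exact recovery" means that $X=zz^T$ is its unique optimal solution. An event $\mathcal{E}$ (depending on $n$) happens with high probability when $\mathbb{P}[\mathcal{E}]=1-n^{-\Omega(1)}$ as $n\to\infty$, i.e. $\mathbb{P}[\mathcal E]\ge 1-n^{-\kappa}$ for some constant $\kappa>0$ and all large $n$. The parameters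 $p$ and $\varepsilon$ may depend on $n$; $\delta$ does not. *)

theory Defs
  imports "HOL-Probability.Probability" "Jordan_Normal_Form.Matrix"
begin

unbundle no vec_syntax
unbundle no inner_syntax

definition sign_vecs :: "nat \<Rightarrow> real vec set" where
  "sign_vecs n = {z \<in> carrier_vec n. \<forall>i<n. z $ i = 1 \<or> z $ i = -1}"

(* Unordered pairs of distinct nodes, each represented by its increasing ordering. *)
definition node_pairs :: "nat \<Rightarrow> (nat \<times> nat) set" where
  "node_pairs n = {(i, j). i < j \<and> j < n}"

definition erdos_renyi :: "nat \<Rightarrow> real \<Rightarrow> (nat \<times> nat \<Rightarrow> bool) pmf" where
  "erdos_renyi n p = Pi_pmf (node_pairs n) False (\<lambda>_. bernoulli_pmf p)"

definition noisy_measurement :: "real \<Rightarrow> real vec \<Rightarrow> nat \<times> nat \<Rightarrow> real pmf" where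
  "noisy_measurement \<epsilon> z = (\<lambda>(i, j).
     map_pmf (\<lambda>flipped. if flipped then - (z $ i * z $ j) else z $ i * z $ j) (bernoulli_pmf \<epsilon>))"

definition z2_sync :: "nat \<Rightarrow> real \<Rightarrow> real \<Rightarrow> real vec \<Rightarrow> real mat pmf" where
  "z2_sync n p \<epsilon> z = do {
     G \<leftarrow> erdos_renyi n p;
     y \<leftarrow> Pi_pmf (node_pairs n) 0
            (\<lambda>e. if G e then noisy_measurement \<epsilon> z e else return_pmf 0);
     return_pmf (mat n n (\<lambda>(i, j).
       if i < j then y (i, j) else if j < i then y (j, i) else 0))
   }"

definition mat_trace :: "real mat \<Rightarrow> real" where
  "mat_trace A = (\<Sum>i<dim_row A. A $$ (i, i))"

definition psd :: "nat \<Rightarrow> real mat \<Rightarrow> bool" where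
  "psd n X \<longleftrightarrow> X \<in> carrier_mat n n \<and> transpose_mat X = X
     \<and> (\<forall>v \<in> carrier_vec n. 0 \<le> v \<bullet> (X *\<^sub>v v))"

definition sdp_feasible :: "nat \<Rightarrow> real mat \<Rightarrow> bool" where
  "sdp_feasible n X \<longleftrightarrow> psd n X \<and> (\<forall>i<n. X $$ (i, i) = 1)"

definition sdp_optimal :: "nat \<Rightarrow> real mat \<Rightarrow> real mat \<Rightarrow> bool" where
  "sdp_optimal n Y = is_arg_max (\<lambda>X. mat_trace (Y * X)) (sdp_feasible n)"

definition planted_mat :: "nat \<Rightarrow> real vec \<Rightarrow> real mat" where
  "planted_mat n z = mat n n (\<lambda>(i, j). z $ i * z $ j)"

definition exact_recovery :: "nat \<Rightarrow> real vec \<Rightarrow> real mat \<Rightarrow> bool" where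
  "exact_recovery n z Y \<longleftrightarrow> {X. sdp_optimal n Y X} = {planted_mat n z}"

(* The probability space, like the event, may depend on n. *)
definition with_high_probability :: "(nat \<Rightarrow> 'a pmf) \<Rightarrow> (nat \<Rightarrow> 'a set) \<Rightarrow> bool" where
  "with_high_probability M E \<longleftrightarrow>
     (\<exists>\<kappa>>0. \<forall>\<^sub>F n in sequentially.
        measure_pmf.prob (M n) (E n) \<ge> 1 - real n powr (- \<kappa>))"

end

theory Submission
  imports Defs "HOL-Real_Asymp.Real_Asymp"
begin

text \<open>
  The proof is by a dual certificate. Multiply the measurements by the planted signs, so that an
  edge carries 1 with probability \<open>1 - \<epsilon>\<close> and -1 with probability \<open>\<epsilon>\<close>, and let \<open>S\<close> be the
  resulting symmetric matrix, \<open>d\<^sub>i\<close> its row sums (the signed degrees) and \<open>N\<close> the matrix \<open>S\<close>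
  with the mean \<open>p * (1 - 2 * \<epsilon>)\<close> subtracted from the off-diagonal entries. The signed Laplacian
  \<open>diag d - S\<close> kills the constants, and on their orthogonal complement it is bounded below by the
  smallest \<open>d\<^sub>i\<close> minus the operator norm of \<open>N\<close>. When this difference is positive, the planted
  matrix is the unique optimum (\<open>recovery_certificate\<close>, \<open>exact_recovery_measured\<close>).

  Put \<open>a = 1 - 2 * \<epsilon>\<close> and \<open>q = (n - 1) * p\<close>. Chernoff's bound at rate \<open>a\<close>
  (\<open>degree_lower_tail\<close>) says that a given \<open>d\<^sub>i\<close> lies below a level \<open>T\<close> with probability at most
  \<open>exp (a * T - a\<^sup>2 * q / 2)\<close>. The hypothesis makes \<open>a\<^sup>2 * q / 2\<close> at least \<open>(1 + \<delta>) * ln n\<close>, which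
  beats the union bound over \<open>n\<close> vertices provided that \<open>a * T\<close> is of smaller order. If \<open>T\<close> is a
  multiple of \<open>sqrt q\<close>, then \<open>a * T\<close> is of the order of the square root of \<open>a\<^sup>2 * q\<close>, as
  needed. So everything rests on an operator norm bound of the optimal order \<open>sqrt (n * p)\<close> for
  the sparse matrix \<open>N\<close>, down to \<open>n * p\<close> of order \<open>ln n\<close> (\<open>noise_norm_tail\<close>).

  That bound comes from the moment method together with a comparison. The expected trace of
  \<open>N ^ m\<close> is a sum over closed walks of length \<open>m\<close>, and the term of a walk depends only on its
  pattern, that is, on the walk up to renaming vertices. A pattern with \<open>v\<close> vertices has at most
  \<open>n ^ v\<close> realisations and at least \<open>v - 1\<close> distinct edges, each of which costs a factor \<open>p\<close>.
  Now let \<open>m \<ge> n * p\<close> and let \<open>X\<close> be a dense random symmetric matrix of size \<open>2 * m\<close> whose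
  entries have moments at least as large as those of \<open>N\<close> divided by \<open>p\<close>. The same pattern has at
  least \<open>m ^ v\<close> realisations there, so the expected trace of \<open>N ^ m\<close> is at most \<open>n / m\<close> times
  that of \<open>X ^ m\<close> (\<open>walk_sum_comparison\<close>, \<open>expectation_noise_trace_pow\<close>). For \<open>X\<close> the size and
  the order of the moment are comparable, and a crude union over exponentially many integer
  vectors suffices to see that its norm is of order \<open>sqrt m\<close> (\<open>expectation_trace_pow_skew\<close>). With
  \<open>m\<close> between \<open>n * p\<close> and \<open>2 * n * p\<close>, Markov's inequality for the trace gives the bound with
  probability at least \<open>1 - 4 * n * exp (- m)\<close>, and \<open>m \<ge> 2 * ln n\<close>.

  Since the factor \<open>1 + \<delta>\<close> absorbs every error term, the constant \<open>K\<close> can be chosen as 0.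
\<close>

section \<open>Quadratic forms, and a certificate for exact recovery\<close>

definition dot :: "nat \<Rightarrow> (nat \<Rightarrow> real) \<Rightarrow> (nat \<Rightarrow> real) \<Rightarrow> real" where
  "dot n x y = (\<Sum>i<n. x i * y i)"

definition app :: "nat \<Rightarrow> (nat \<Rightarrow> nat \<Rightarrow> real) \<Rightarrow> (nat \<Rightarrow> real) \<Rightarrow> nat \<Rightarrow> real" where
  "app n A x i = (\<Sum>j<n. A i j * x j)"

lemma quad_Suc:
  assumes "\<And>i. i < n \<Longrightarrow> P i n = P n i"
  shows "dot (Suc n) y (app (Suc n) P y)
    = dot n y (app n P y) + 2 * y n * (\<Sum>i<n. y i * P i n) + (y n)\<^sup>2 * P n n"
proof -
  have "(\<Sum>j<n. P n j * y j) = (\<Sum>i<n. y i * P i n)"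
    using assms by (intro sum.cong) auto
  moreover have "(\<Sum>i<n. y i * (P i n * y n)) = y n * (\<Sum>i<n. y i * P i n)"
    by (simp add: sum_distrib_left algebra_simps)
  ultimately show ?thesis
    by (simp add: dot_def app_def sum.distrib distrib_left power2_eq_square algebra_simps)
qed

text \<open>
  Symmetric Gaussian elimination of the last index: the Schur complement
  \<open>P i j - P i n * P j n / P n n\<close> is again positive semidefinite, and the part removed is
  one square. A vanishing pivot forces its whole row to vanish, since otherwise the form would
  take a negative value on the plane of the two indices; so \<open>x / 0 = 0\<close> makes the same formulas
  correct in that case.
\<close>

lemma psd_sum_of_squares:
  fixes P :: "nat \<Rightarrow> nat \<Rightarrow> real"
  assumes "\<And>i j. i < n \<Longrightarrow> j < n \<Longrightarrow> P i j = P j i"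
    and "\<And>x. 0 \<le> dot n x (app n P x)"
  shows "\<exists>V. \<forall>i<n. \<forall>j<n. P i j = (\<Sum>k<n. V k i * V k j)"
  using assms
proof (induction n arbitrary: P)
  case 0
  then show ?case by simp
next
  case (Suc n)
  define d where "d = P n n"
  have sym: "P i n = P n i" if "i < n" for i using Suc.prems(1) that by simp
  have expand: "0 \<le> dot n y (app n P y) + 2 * y n * (\<Sum>i<n. y i * P i n) + (y n)\<^sup>2 * d" for y
    using Suc.prems(2)[of y] quad_Suc[of n P y] sym unfolding d_def by simp
  have d0: "0 \<le> d"
    using expand[of "\<lambda>k. if k = n then 1 else 0"] by (simp add: dot_def app_def)
  have row0: "P i n = 0" if "d = 0" "i < n" for i
  proof (rule ccontr)
    assume ne: "P i n \<noteq> 0"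
    \<comment> \<open>with this weight on index \<open>n\<close> and weight 1 on index \<open>i\<close> the form takes the value -1\<close>
    define t where "t = - (P i i + 1) / (2 * P i n)"
    define y where "y = (\<lambda>k. if k = i then 1 else if k = n then t else 0)"
    have "(\<Sum>k<n. y k * P k n) = P i n"
      using that(2) by (simp add: y_def if_distrib[of "\<lambda>u. u * _"] sum.If_cases
          if_distribR sum.delta cong: if_cong)
    moreover have "app n P y k = P k i" if "k < n" for k
    proof -
      have "app n P y k = (\<Sum>j<n. if j = i then P k j else 0)"
        unfolding app_def y_def by (intro sum.cong) auto
      then show ?thesis using \<open>i < n\<close> by simp
    qed
    then have "dot n y (app n P y) = (\<Sum>k<n. if k = i then P i i else 0)"
      unfolding dot_def by (intro sum.cong) (auto simp: y_def)
    then have "dot n y (app n P y) = P i i" using that(2) by simp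
    ultimately have "0 \<le> P i i + 2 * t * P i n"
      using expand[of y] that by (simp add: y_def)
    also have "2 * t * P i n = - (P i i + 1)" using ne by (simp add: t_def field_simps)
    finally show False by simp
  qed
  define P' where "P' = (\<lambda>i j. P i j - P i n * P j n / d)"
  have quad': "dot n x (app n P' x) = dot n x (app n P x) - (\<Sum>i<n. x i * P i n)\<^sup>2 / d" for x
  proof -
    have "P' i j * x j = P i j * x j - P i n / d * (x j * P j n)" for i j
      by (simp add: P'_def algebra_simps)
    moreover define b where "b = (\<Sum>j<n. x j * P j n) / d"
    ultimately have "app n P' x i = app n P x i - P i n * b" for i
      by (simp add: app_def sum_subtractf sum_distrib_left sum_divide_distrib)
    then have "dot n x (app n P' x) = dot n x (app n P x) - (\<Sum>i<n. x i * P i n) * b"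
      by (simp add: dot_def right_diff_distrib sum_subtractf sum_distrib_right mult.assoc)
    then show ?thesis by (simp add: b_def power2_eq_square)
  qed
  have psd': "0 \<le> dot n x (app n P' x)" for x
  proof (cases "d = 0")
    case True
    have "dot n (x(n := 0)) (app n P (x(n := 0))) = dot n x (app n P x)"
      by (simp add: dot_def app_def)
    then show ?thesis using expand[of "x(n := 0)"] True by (simp add: quad')
  next
    case False
    define b where "b = (\<Sum>i<n. x i * P i n)"
    \<comment> \<open>the last coordinate that minimises the form\<close>
    define y where "y = x(n := - b / d)"
    have "dot n y (app n P y) = dot n x (app n P x)" "(\<Sum>i<n. y i * P i n) = b"
      by (simp_all add: dot_def app_def y_def b_def)
    then have "0 \<le> dot n x (app n P x) + 2 * (- b / d) * b + (- b / d)\<^sup>2 * d"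
      using expand[of y] by (simp add: y_def)
    also have "\<dots> = dot n x (app n P x) - b\<^sup>2 / d"
      using False by (simp add: field_simps power2_eq_square)
    finally show ?thesis by (simp add: quad' b_def)
  qed
  have sym': "P' i j = P' j i" if "i < n" "j < n" for i j
    using that Suc.prems(1) by (simp add: P'_def)
  from Suc.IH[of P', OF sym' psd'] obtain V
    where V: "\<And>i j. i < n \<Longrightarrow> j < n \<Longrightarrow> P' i j = (\<Sum>k<n. V k i * V k j)" by auto
  define W where "W = (\<lambda>k i. if k < n then (if i < n then V k i else 0) else P i n / sqrt d)"
  have "P i j = (\<Sum>k<Suc n. W k i * W k j)" if "i < Suc n" "j < Suc n" for i j
  proof -
    have "(\<Sum>k<n. W k i * W k j) = (if i < n \<and> j < n then P' i j else 0)"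
      using V by (cases "i < n"; cases "j < n") (simp_all add: W_def)
    moreover have "W n i * W n j = P i n * P j n / d"
      using d0 by (simp add: W_def)
    moreover have "P n n * P n n / d = P n n" by (simp add: d_def)
    moreover have "P i n * P n n / d = P i n" if "i < n" for i
      using row0 that d_def by (cases "d = 0") auto
    ultimately show ?thesis
      using that sym by (auto simp: P'_def less_Suc_eq mult.commute)
  qed
  then show ?case by blast
qed

text \<open>
  The hypothesis bounds the form of the dual slack matrix (signed degrees on the diagonal, minus
  \<open>Y\<close>) from below by \<open>c\<close> times the squared distance to the line through \<open>z\<close>. Writing a
  feasible \<open>X\<close> as a sum of squares and adding the bound over the summands shows that the
  objective of \<open>X\<close> falls short of that of the planted matrix by at least
  \<open>c * (n - (z\<^sup>T X z) / n)\<close>, and this is positive unless every entry of \<open>X\<close> is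
  \<open>z\<^sub>i * z\<^sub>j\<close>.
\<close>

lemma recovery_certificate:
  assumes n: "0 < n" and z: "z \<in> sign_vecs n" and Y: "Y \<in> carrier_mat n n"
    and c: "0 < c"
    and L: "\<And>x. c * (dot n x x - (dot n (($) z) x)\<^sup>2 / n)
      \<le> (\<Sum>i<n. (\<Sum>j<n. Y $$ (i, j) * z $ i * z $ j) * (x i)\<^sup>2)
        - dot n x (app n (\<lambda>i j. Y $$ (i, j)) x)"
  shows "exact_recovery n z Y"
proof -
  let ?Z = "planted_mat n z" and ?Y = "\<lambda>i j. Y $$ (i, j)"
  let ?f = "\<lambda>X. mat_trace (Y * X)"
  have zz: "z $ i * z $ i = 1" if "i < n" for i using z that by (auto simp: sign_vecs_def)
  have tr: "?f X = (\<Sum>i<n. \<Sum>j<n. ?Y i j * X $$ (j, i))" if "X \<in> carrier_mat n n" for X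
    using that Y by (simp add: mat_trace_def scalar_prod_def atLeast0LessThan)
  have Zc: "?Z \<in> carrier_mat n n" by (simp add: planted_mat_def)
  have form: "v \<bullet> (X *\<^sub>v v) = dot n (($) v) (app n (\<lambda>i j. X $$ (i, j)) (($) v))"
    if "v \<in> carrier_vec n" "X \<in> carrier_mat n n" for v :: "real vec" and X
    using that by (simp add: dot_def app_def scalar_prod_def atLeast0LessThan)
  have psdD: "0 \<le> dot n x (app n (\<lambda>i j. X $$ (i, j)) x)" if "psd n X" for X x
  proof -
    have "0 \<le> vec n x \<bullet> (X *\<^sub>v vec n x)" using that by (simp add: psd_def)
    also have "\<dots> = dot n x (app n (\<lambda>i j. X $$ (i, j)) x)"
      using that by (subst form) (auto simp: psd_def dot_def app_def)
    finally show ?thesis .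
  qed
  have Zf: "sdp_feasible n ?Z"
  proof -
    have "0 \<le> v \<bullet> (?Z *\<^sub>v v)" if "v \<in> carrier_vec n" for v
    proof -
      have "v \<bullet> (?Z *\<^sub>v v) = (\<Sum>i<n. v $ i * z $ i)\<^sup>2"
        using that by (simp add: form[OF _ Zc]) (simp add: planted_mat_def dot_def app_def
            power2_eq_square sum_product sum_distrib_left mult_ac)
      then show ?thesis by simp
    qed
    then show ?thesis
      using zz by (auto simp: sdp_feasible_def psd_def planted_mat_def intro!: eq_matI)
  qed
  have better: "?f X < ?f ?Z" if X: "sdp_feasible n X" "X \<noteq> ?Z" for X
  proof -
    have Xc: "X \<in> carrier_mat n n" and Xp: "psd n X"
      using X by (auto simp: sdp_feasible_def psd_def)
    have sym: "X $$ (i, j) = X $$ (j, i)" if "i < n" "j < n" for i j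
    proof -
      have "transpose_mat X = X" using Xp by (simp add: psd_def)
      then have "X $$ (i, j) = transpose_mat X $$ (i, j)" by simp
      also have "\<dots> = X $$ (j, i)" using Xc that by simp
      finally show ?thesis .
    qed
    obtain V where V: "\<And>i j. i < n \<Longrightarrow> j < n \<Longrightarrow> X $$ (i, j) = (\<Sum>k<n. V k i * V k j)"
      using psd_sum_of_squares[of n "\<lambda>i j. X $$ (i, j)", OF sym psdD[OF Xp]] by blast
    have diag: "(\<Sum>k<n. (V k i)\<^sup>2) = 1" if "i < n" for i
      using V[OF that that] X that by (simp add: sdp_feasible_def power2_eq_square)
    have e1: "(\<Sum>k<n. dot n (V k) (V k)) = n"
    proof -
      have "(\<Sum>k<n. dot n (V k) (V k)) = (\<Sum>i<n. \<Sum>k<n. (V k i)\<^sup>2)"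
        unfolding dot_def by (subst sum.swap) (simp add: power2_eq_square)
      then show ?thesis by (simp add: diag)
    qed
    have e2: "(\<Sum>k<n. (dot n (($) z) (V k))\<^sup>2) = (\<Sum>i<n. \<Sum>j<n. z $ i * z $ j * X $$ (i, j))"
    proof -
      have "(dot n (($) z) (V k))\<^sup>2 = (\<Sum>i<n. \<Sum>j<n. z $ i * z $ j * (V k i * V k j))" for k
        by (simp add: dot_def power2_eq_square sum_product mult_ac)
      then have "(\<Sum>k<n. (dot n (($) z) (V k))\<^sup>2)
          = (\<Sum>i<n. \<Sum>k<n. \<Sum>j<n. z $ i * z $ j * (V k i * V k j))"
        by (simp only:) (rule sum.swap)
      also have "\<dots> = (\<Sum>i<n. \<Sum>j<n. \<Sum>k<n. z $ i * z $ j * (V k i * V k j))"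
        by (intro sum.cong refl sum.swap)
      also have "\<dots> = (\<Sum>i<n. \<Sum>j<n. z $ i * z $ j * X $$ (i, j))"
        using V by (simp add: sum_distrib_left)
      finally show ?thesis .
    qed
    have e3: "(\<Sum>k<n. \<Sum>i<n. (\<Sum>j<n. ?Y i j * z $ i * z $ j) * (V k i)\<^sup>2) = ?f ?Z"
    proof -
      have "(\<Sum>k<n. \<Sum>i<n. (\<Sum>j<n. ?Y i j * z $ i * z $ j) * (V k i)\<^sup>2)
          = (\<Sum>i<n. (\<Sum>j<n. ?Y i j * z $ i * z $ j) * (\<Sum>k<n. (V k i)\<^sup>2))"
        by (subst sum.swap) (simp add: sum_distrib_left)
      then show ?thesis by (simp add: diag tr[OF Zc]) (simp add: planted_mat_def mult_ac)
    qed
    have e4: "(\<Sum>k<n. dot n (V k) (app n ?Y (V k))) = ?f X"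
    proof -
      have "(\<Sum>k<n. dot n (V k) (app n ?Y (V k)))
          = (\<Sum>i<n. \<Sum>k<n. \<Sum>j<n. ?Y i j * (V k j * V k i))"
        by (subst sum.swap) (simp add: dot_def app_def sum_distrib_left mult_ac)
      also have "\<dots> = (\<Sum>i<n. \<Sum>j<n. \<Sum>k<n. ?Y i j * (V k j * V k i))"
        by (intro sum.cong refl sum.swap)
      finally show ?thesis by (simp add: tr[OF Xc] V sum_distrib_left)
    qed
    let ?s = "\<Sum>i<n. \<Sum>j<n. z $ i * z $ j * X $$ (i, j)"
    have "(\<Sum>k<n. c * (dot n (V k) (V k) - (dot n (($) z) (V k))\<^sup>2 / n)) \<le> ?f ?Z - ?f X"
      unfolding e3[symmetric] e4[symmetric] sum_subtractf[symmetric] by (intro sum_mono L)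
    then have gap: "c * (n - ?s / n) \<le> ?f ?Z - ?f X"
      by (simp add: sum_distrib_left[symmetric] sum_subtractf sum_divide_distrib[symmetric] e1 e2)
    \<comment> \<open>\<open>?s\<close> is at most \<open>n\<^sup>2\<close> because a correlation matrix has entries in [-1, 1]\<close>
    have le1: "z $ i * z $ j * X $$ (i, j) \<le> 1" if "i < n" "j < n" for i j
    proof -
      have "0 \<le> (\<Sum>k<n. (z $ i * V k i - z $ j * V k j)\<^sup>2)" by (intro sum_nonneg) auto
      also have "\<dots> = (\<Sum>k<n. (z $ i * z $ i) * (V k i)\<^sup>2 + (z $ j * z $ j) * (V k j)\<^sup>2
          - 2 * (z $ i * z $ j) * (V k i * V k j))"
        by (intro sum.cong refl) (simp add: power2_eq_square algebra_simps)
      also have "\<dots> = 2 - 2 * (z $ i * z $ j) * X $$ (i, j)"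
        using that by (simp add: zz diag V sum.distrib sum_subtractf sum_distrib_left)
      finally show ?thesis by simp
    qed
    obtain i j where ij: "i < n" "j < n" "X $$ (i, j) \<noteq> z $ i * z $ j"
    proof (rule ccontr)
      assume "\<not> thesis"
      with that have "X $$ (i, j) = ?Z $$ (i, j)" if "i < n" "j < n" for i j
        using that by (auto simp: planted_mat_def)
      with Xc Zc have "X = ?Z" by (intro eq_matI) auto
      with X(2) show False ..
    qed
    have lt1: "z $ i * z $ j * X $$ (i, j) < 1"
    proof -
      have "z $ i * z $ j * X $$ (i, j) \<noteq> 1"
      proof
        assume "z $ i * z $ j * X $$ (i, j) = 1"
        then have "(z $ i * z $ i) * (z $ j * z $ j) * X $$ (i, j) = z $ i * z $ j"
          by (metis mult.assoc mult.left_commute mult.right_neutral)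
        with ij zz show False by simp
      qed
      then show ?thesis using le1[OF ij(1,2)] by simp
    qed
    have "?s < (\<Sum>i<n. \<Sum>j<n. 1)"
    proof (rule sum_strict_mono_ex1)
      show "\<forall>i\<in>{..<n}. (\<Sum>j<n. z $ i * z $ j * X $$ (i, j)) \<le> (\<Sum>j<n. 1)"
        by (auto intro!: sum_mono le1 simp del: sum_constant)
      have "(\<Sum>j<n. z $ i * z $ j * X $$ (i, j)) < (\<Sum>j<n. 1)"
        using ij lt1 le1 by (intro sum_strict_mono_ex1) auto
      then show "\<exists>i\<in>{..<n}. (\<Sum>j<n. z $ i * z $ j * X $$ (i, j)) < (\<Sum>j<n. 1)"
        using ij by blast
    qed simp
    then have "?s < real n * real n" by simp
    then have "0 < real n - ?s / n" using n by (simp add: field_simps)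
    then have "0 < c * (real n - ?s / n)" using c by simp
    then show ?thesis using gap by linarith
  qed
  have "sdp_optimal n Y X \<longleftrightarrow> X = ?Z" for X
    unfolding sdp_optimal_def is_arg_max_def using better Zf by (metis order_less_asym)
  then show ?thesis by (auto simp: exact_recovery_def)
qed

section \<open>Powers of symmetric matrices\<close>

definition unit_at :: "nat \<Rightarrow> nat \<Rightarrow> real" where
  "unit_at i = (\<lambda>j. if j = i then 1 else 0)"

definition trace_pow :: "nat \<Rightarrow> (nat \<Rightarrow> nat \<Rightarrow> real) \<Rightarrow> nat \<Rightarrow> real" where
  "trace_pow n A m = (\<Sum>i<n. (app n A ^^ m) (unit_at i) i)"

lemma dot_commute: "dot n x y = dot n y x"
  by (simp add: dot_def mult.commute)

lemma dot_self_nonneg [simp]: "0 \<le> dot n x x"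
  by (simp add: dot_def sum_nonneg)

lemma dot_self_eq_0_iff: "dot n x x = 0 \<longleftrightarrow> (\<forall>i<n. x i = 0)"
  unfolding dot_def by (subst sum_nonneg_eq_0_iff) auto

lemma dot_unit_at [simp]: "i < n \<Longrightarrow> dot n (unit_at i) x = x i"
  by (simp add: dot_def unit_at_def if_distrib[of "\<lambda>u. u * _"] sum.delta cong: if_cong)

lemma dot_scale: "dot n (\<lambda>i. c * x i) y = c * dot n x y" "dot n x (\<lambda>i. c * y i) = c * dot n x y"
  by (simp_all add: dot_def sum_distrib_left mult_ac)

lemma app_scale: "app n A (\<lambda>i. c * x i) = (\<lambda>i. c * app n A x i)"
  by (simp add: app_def sum_distrib_left mult_ac fun_eq_iff)

lemma dot_Cauchy_Schwarz: "(dot n x y)\<^sup>2 \<le> dot n x x * dot n y y"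
  using Cauchy_Schwarz_ineq_sum[of x y "{..<n}"] by (simp add: dot_def power2_eq_square)

lemma funpow_add_apply: "(f ^^ a) ((f ^^ b) x) = (f ^^ (a + b)) x"
  by (simp add: funpow_add)

context
  fixes n :: nat and A :: "nat \<Rightarrow> nat \<Rightarrow> real"
  assumes sym: "\<And>i j. i < n \<Longrightarrow> j < n \<Longrightarrow> A i j = A j i"
begin

lemma dot_app_sym: "dot n x (app n A y) = dot n (app n A x) y"
proof -
  have "dot n x (app n A y) = (\<Sum>i<n. \<Sum>j<n. x i * A i j * y j)"
    by (simp add: dot_def app_def sum_distrib_left mult_ac)
  also have "\<dots> = (\<Sum>j<n. \<Sum>i<n. x i * A i j * y j)" by (rule sum.swap)
  also have "\<dots> = (\<Sum>j<n. \<Sum>i<n. A j i * x i * y j)"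
    using sym by (intro sum.cong refl) (simp add: mult_ac)
  finally show ?thesis by (simp add: dot_def app_def sum_distrib_right)
qed

lemma dot_pow_sym: "dot n x ((app n A ^^ k) y) = dot n ((app n A ^^ k) x) y"
proof (induction k arbitrary: x)
  case (Suc k)
  have "dot n x ((app n A ^^ Suc k) y) = dot n ((app n A ^^ k) (app n A x)) y"
    by (simp add: dot_app_sym Suc)
  then show ?case by (simp add: funpow_swap1)
qed simp

lemma dot_pow_double:
  "dot n x ((app n A ^^ (2 * k)) x) = dot n ((app n A ^^ k) x) ((app n A ^^ k) x)"
  by (subst dot_pow_sym[symmetric]) (simp add: funpow_add_apply mult_2)

lemma trace_pow_double:
  "trace_pow n A (2 * k) = (\<Sum>i<n. dot n ((app n A ^^ k) (unit_at i)) ((app n A ^^ k) (unit_at i)))"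
  unfolding trace_pow_def by (intro sum.cong refl) (simp flip: dot_pow_double)

text \<open>
  An even power of a symmetric matrix is a square, hence positive semidefinite, and its form is
  dominated by its trace.
\<close>

lemma quad_pow_le_trace:
  "dot n x ((app n A ^^ (2 * k)) x) \<le> dot n x x * trace_pow n A (2 * k)"
proof -
  let ?P = "app n A ^^ k"
  have "dot n x ((app n A ^^ (2 * k)) x) = (\<Sum>i<n. (dot n (unit_at i) (?P x))\<^sup>2)"
    by (simp add: dot_pow_double) (simp add: dot_def power2_eq_square)
  also have "\<dots> = (\<Sum>i<n. (dot n (?P (unit_at i)) x)\<^sup>2)"
    by (simp only: dot_pow_sym)
  also have "\<dots> \<le> (\<Sum>i<n. dot n (?P (unit_at i)) (?P (unit_at i)) * dot n x x)"
    by (intro sum_mono dot_Cauchy_Schwarz)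
  finally show ?thesis
    by (simp only: trace_pow_double sum_distrib_left mult.commute[of "dot n x x"])
qed

text \<open>
  With \<open>a m\<close> denoting the form of the \<open>m\<close>-th power at \<open>x\<close>, the Cauchy-Schwarz inequality
  gives \<open>(a m)\<^sup>2 \<le> a 0 * a (2 * m)\<close>; iterating this over powers of two replaces the spectral
  theorem. The surplus factor \<open>dot n x x\<close> avoids a subtraction in the exponent.
\<close>

lemma quad_pow_two:
  "\<bar>dot n x (app n A x)\<bar> ^ (2 ^ s) * dot n x x
     \<le> \<bar>dot n x ((app n A ^^ (2 ^ s)) x)\<bar> * dot n x x ^ (2 ^ s)"
proof (cases "dot n x x = 0")
  case True
  then show ?thesis by simp
next
  case False
  then have D: "0 < dot n x x" using dot_self_nonneg[of n x] by linarith
  show ?thesis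
  proof (induction s)
    case 0
    then show ?case by simp
  next
    case (Suc s)
    let ?a = "\<lambda>m. dot n x ((app n A ^^ m) x)" and ?D = "dot n x x"
    have "(?a (2 ^ s))\<^sup>2 \<le> ?D * ?a (2 ^ Suc s)"
      using dot_Cauchy_Schwarz[of n x] by (simp add: dot_pow_double)
    then have CS: "(?a (2 ^ s))\<^sup>2 \<le> ?D * \<bar>?a (2 ^ Suc s)\<bar>"
      using D by (elim order_trans) (intro mult_left_mono abs_ge_self, simp)
    have "(\<bar>?a 1\<bar> ^ (2 ^ s) * ?D)\<^sup>2 \<le> (\<bar>?a (2 ^ s)\<bar> * ?D ^ (2 ^ s))\<^sup>2"
      using Suc D by (intro power_mono) (auto intro!: mult_nonneg_nonneg)
    then have "\<bar>?a 1\<bar> ^ (2 ^ Suc s) * ?D * ?D \<le> (?a (2 ^ s))\<^sup>2 * ?D ^ (2 ^ Suc s)"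
      by (simp add: power_mult_distrib power2_eq_square power_add mult_2 mult_ac)
    also have "\<dots> \<le> ?D * \<bar>?a (2 ^ Suc s)\<bar> * ?D ^ (2 ^ Suc s)"
      using CS D by (intro mult_right_mono) auto
    finally have "?D * (\<bar>?a 1\<bar> ^ (2 ^ Suc s) * ?D) \<le> ?D * (\<bar>?a (2 ^ Suc s)\<bar> * ?D ^ (2 ^ Suc s))"
      by (simp only: mult_ac)
    then show ?case using D by (simp only: mult_le_cancel_left_pos) simp
  qed
qed

lemma quad_le_trace_pow:
  "\<bar>dot n x (app n A x)\<bar> ^ (2 ^ Suc s) \<le> trace_pow n A (2 ^ Suc s) * dot n x x ^ (2 ^ Suc s)"
proof (cases "dot n x x = 0")
  case True
  then have "dot n x (app n A x) = 0" by (simp add: dot_self_eq_0_iff) (simp add: dot_def)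
  with True show ?thesis by (simp only: abs_zero) (simp add: power_0_left)
next
  case False
  then have D: "0 < dot n x x" using dot_self_nonneg[of n x] by linarith
  have nn: "0 \<le> dot n x ((app n A ^^ (2 ^ Suc s)) x)" by (simp add: dot_pow_double)
  have "\<bar>dot n x (app n A x)\<bar> ^ (2 ^ Suc s) * dot n x x
      \<le> dot n x ((app n A ^^ (2 ^ Suc s)) x) * dot n x x ^ (2 ^ Suc s)"
    using quad_pow_two[of x "Suc s"] nn by simp
  also have "\<dots> \<le> (dot n x x * trace_pow n A (2 ^ Suc s)) * dot n x x ^ (2 ^ Suc s)"
    using quad_pow_le_trace[of x "2 ^ s"] by (intro mult_right_mono) simp_all
  finally have "dot n x x * \<bar>dot n x (app n A x)\<bar> ^ (2 ^ Suc s)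
      \<le> dot n x x * (trace_pow n A (2 ^ Suc s) * dot n x x ^ (2 ^ Suc s))"
    by (simp only: mult_ac)
  then show ?thesis using D by (simp only: mult_le_cancel_left_pos)
qed

text \<open>
  A bound on the bilinear form over pairs of unit vectors is a bound on the operator norm: take
  the second vector parallel to the image of the first.
\<close>

lemma trace_pow_le:
  fixes B :: real
  assumes B: "\<And>x y. dot n x x \<le> 1 \<Longrightarrow> dot n y y \<le> 1 \<Longrightarrow> dot n y (app n A x) \<le> B"
  shows "trace_pow n A (2 * k) \<le> n * B ^ (2 * k)"
proof -
  have contract: "dot n (app n A x) (app n A x) \<le> B\<^sup>2 * dot n x x" for x
  proof (cases "dot n x x = 0 \<or> dot n (app n A x) (app n A x) = 0")
    case True
    then have "dot n (app n A x) (app n A x) = 0"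
      by (auto simp: dot_self_eq_0_iff) (simp add: app_def)
    then show ?thesis by simp
  next
    case False
    define u v where "u = sqrt (dot n x x)" and "v = sqrt (dot n (app n A x) (app n A x))"
    have uv: "0 < u" "0 < v" using False dot_self_nonneg[of n] by (auto simp: u_def v_def less_le)
    have u2: "dot n x x = u\<^sup>2" and v2: "dot n (app n A x) (app n A x) = v\<^sup>2"
      by (simp_all add: u_def v_def)
    have "dot n (\<lambda>i. 1 / v * app n A x i) (app n A (\<lambda>i. 1 / u * x i)) \<le> B"
      using uv by (intro B) (simp_all only: dot_scale u2 v2, simp_all add: power2_eq_square)
    then have "v \<le> B * u"
      unfolding app_scale dot_scale v2 using uv by (simp add: power2_eq_square field_simps)
    then have "v\<^sup>2 \<le> (B * u)\<^sup>2" using uv by (intro power_mono) auto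
    then show ?thesis by (simp add: u2 v2 power_mult_distrib)
  qed
  have pow: "dot n ((app n A ^^ k) x) ((app n A ^^ k) x) \<le> (B\<^sup>2) ^ k * dot n x x" for x
  proof (induction k)
    case (Suc k)
    have "dot n ((app n A ^^ Suc k) x) ((app n A ^^ Suc k) x)
        \<le> B\<^sup>2 * dot n ((app n A ^^ k) x) ((app n A ^^ k) x)" by (simp add: contract)
    also have "\<dots> \<le> B\<^sup>2 * ((B\<^sup>2) ^ k * dot n x x)" by (intro mult_left_mono Suc) simp
    finally show ?case by simp
  qed simp
  have "trace_pow n A (2 * k) \<le> (\<Sum>i<n. (B\<^sup>2) ^ k * dot n (unit_at i) (unit_at i))"
    unfolding trace_pow_double by (intro sum_mono pow)
  also have "\<dots> = (\<Sum>i<n. (B\<^sup>2) ^ k)" by (intro sum.cong) (simp_all, simp add: unit_at_def)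
  finally show ?thesis by (simp add: power_mult)
qed

end

section \<open>Integer vectors that norm the unit ball\<close>

text \<open>
  Scaled by \<open>sqrt n\<close>, the unit ball lies in the convex hull of these integer vectors. A linear
  functional is increased by rounding each coordinate up or down according to the sign of its
  coefficient, so maximising a bilinear form over the unit ball needs no approximation argument:
  the maximum over integer vectors dominates it outright.
\<close>

definition int_net :: "nat \<Rightarrow> (nat \<Rightarrow> int) set" where
  "int_net n = {y \<in> {..<n} \<rightarrow>\<^sub>E UNIV. (\<Sum>i<n. (y i)\<^sup>2) \<le> 4 * int n}"

lemma int_net_rounding:
  assumes "dot n x x \<le> 1"
  obtains y where "y \<in> int_net n" "sqrt n * dot n x c \<le> dot n (\<lambda>i. real_of_int (y i)) c"
proof
  define u where "u = (\<lambda>i. sqrt n * x i)"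
  define y where "y = (\<lambda>i\<in>{..<n}. if 0 \<le> c i then \<lceil>u i\<rceil> else \<lfloor>u i\<rfloor>)"
  have "real_of_int (\<Sum>i<n. (y i)\<^sup>2) \<le> (\<Sum>i<n. 2 * (u i)\<^sup>2 + 2)"
  proof (simp only: of_int_sum, rule sum_mono)
    fix i assume "i \<in> {..<n}"
    then have "\<bar>real_of_int (y i) - u i\<bar> \<le> 1" by (simp add: y_def) linarith
    then have "(real_of_int (y i) - u i)\<^sup>2 \<le> 1" by (simp add: abs_square_le_1)
    moreover have "0 \<le> (real_of_int (y i) - 2 * u i)\<^sup>2" by simp
    ultimately show "real_of_int ((y i)\<^sup>2) \<le> 2 * (u i)\<^sup>2 + 2"
      by (simp add: power2_eq_square algebra_simps)
  qed
  also have "\<dots> = 2 * real n * dot n x x + 2 * real n"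
  proof -
    have "2 * (u i)\<^sup>2 = 2 * n * (x i * x i)" for i
      by (simp add: u_def power_mult_distrib) (simp add: power2_eq_square)
    then show ?thesis by (simp add: sum.distrib dot_def sum_distrib_left mult.assoc)
  qed
  also have "\<dots> \<le> 2 * real n * 1 + 2 * real n" using assms by (intro add_right_mono mult_left_mono) auto
  finally have "real_of_int (\<Sum>i<n. (y i)\<^sup>2) \<le> real_of_int (4 * int n)" by simp
  then have "(\<Sum>i<n. (y i)\<^sup>2) \<le> 4 * int n" by (simp only: of_int_le_iff)
  then show "y \<in> int_net n" by (simp add: int_net_def) (simp add: y_def)
  have "u i * c i \<le> real_of_int (y i) * c i" if "i < n" for i
    using that by (auto simp: y_def intro: mult_right_mono mult_right_mono_neg)
  then show "sqrt n * dot n x c \<le> dot n (\<lambda>i. real_of_int (y i)) c"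
    unfolding dot_def sum_distrib_left mult.assoc[symmetric] by (intro sum_mono) (simp add: u_def)
qed

text \<open>
  Both arguments are rounded in turn, each against the linear functional given by the other.
\<close>

lemma bilinear_le_int_net:
  assumes sym: "\<And>i j. i < n \<Longrightarrow> j < n \<Longrightarrow> A i j = A j i"
    and "dot n x x \<le> 1" "dot n y y \<le> 1"
  obtains u v where "u \<in> int_net n" "v \<in> int_net n"
    "n * dot n y (app n A x) \<le> dot n (\<lambda>i. real_of_int (u i)) (app n A (\<lambda>i. real_of_int (v i)))"
proof -
  obtain u where u: "u \<in> int_net n"
    "sqrt n * dot n y (app n A x) \<le> dot n (\<lambda>i. real_of_int (u i)) (app n A x)"
    using int_net_rounding[OF assms(3)] by blast
  let ?u = "\<lambda>i. real_of_int (u i)"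
  obtain v where v: "v \<in> int_net n"
    "sqrt n * dot n x (app n A ?u) \<le> dot n (\<lambda>i. real_of_int (v i)) (app n A ?u)"
    using int_net_rounding[OF assms(2)] by blast
  let ?v = "\<lambda>i. real_of_int (v i)"
  have "n * dot n y (app n A x) = sqrt n * (sqrt n * dot n y (app n A x))" by simp
  also have "\<dots> \<le> sqrt n * dot n ?u (app n A x)" using u by (intro mult_left_mono) auto
  also have "dot n ?u (app n A x) = dot n x (app n A ?u)"
    by (metis dot_app_sym[of n A, OF sym] dot_commute)
  also have "sqrt n * dot n x (app n A ?u) \<le> dot n ?v (app n A ?u)" by (fact v)
  also have "dot n ?v (app n A ?u) = dot n ?u (app n A ?v)"
    by (metis dot_app_sym[of n A, OF sym] dot_commute)
  finally show thesis using that u v by blast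
qed

lemma sum_half_power_eq: "(\<Sum>t\<in>{- int b..int b}. (1 / 2 :: real) ^ nat \<bar>t\<bar>) = 3 - 2 * (1 / 2) ^ b"
proof (induction b)
  case (Suc b)
  have "{- int (Suc b)..int (Suc b)} = insert (int (Suc b)) (insert (- int (Suc b)) {- int b..int b})"
    by auto
  then show ?case using Suc by (simp add: nat_add_distrib)
qed simp

lemma int_abs_le_square: "\<bar>t\<bar> \<le> t\<^sup>2" for t :: int
  using mult_left_mono[of 1 "\<bar>t\<bar>" "\<bar>t\<bar>"] by (cases "t = 0") (auto simp: power2_eq_square)

lemma int_net_subset: "int_net n \<subseteq> (\<Pi>\<^sub>E i\<in>{..<n}. {- int (4 * n)..int (4 * n)})"
proof (rule subsetI, rule PiE_I)
  fix y i assume y: "y \<in> int_net n" and i: "i \<in> {..<n}"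
  have "\<bar>y i\<bar> \<le> (y i)\<^sup>2" by (rule int_abs_le_square)
  also have "\<dots> \<le> (\<Sum>i<n. (y i)\<^sup>2)" using i by (intro member_le_sum) auto
  also have "\<dots> \<le> 4 * int n" using y by (simp add: int_net_def)
  finally show "y i \<in> {- int (4 * n)..int (4 * n)}" by auto
qed (auto simp: int_net_def)

lemma finite_int_net [simp]: "finite (int_net n)"
  by (rule finite_subset[OF int_net_subset]) (auto intro!: finite_PiE)

text \<open>
  Integers satisfy \<open>\<bar>t\<bar> \<le> t\<^sup>2\<close>, so every vector of the net has weight at least
  \<open>(1 / 2) ^ (4 * n)\<close> under the product weight \<open>(1 / 2) ^ \<bar>t\<bar>\<close>, whose total mass is at most
  \<open>3 ^ n\<close>.
\<close>

lemma card_int_net: "real (card (int_net n)) \<le> 48 ^ n"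
proof -
  let ?I = "{- int (4 * n)..int (4 * n)}"
  have one: "1 \<le> 16 ^ n * (\<Prod>i<n. (1 / 2 :: real) ^ nat \<bar>y i\<bar>)" if "y \<in> int_net n" for y
  proof -
    have "(\<Sum>i<n. \<bar>y i\<bar>) \<le> (\<Sum>i<n. (y i)\<^sup>2)" by (intro sum_mono int_abs_le_square)
    also have "\<dots> \<le> 4 * int n" using that by (simp add: int_net_def)
    finally have "int (\<Sum>i<n. nat \<bar>y i\<bar>) \<le> int (4 * n)" by simp
    then have "(\<Sum>i<n. nat \<bar>y i\<bar>) \<le> 4 * n" by (simp only: of_nat_le_iff)
    then have "(1 / 2 :: real) ^ (4 * n) \<le> (1 / 2) ^ (\<Sum>i<n. nat \<bar>y i\<bar>)"
      by (intro power_decreasing) auto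
    also have "\<dots> = (\<Prod>i<n. (1 / 2) ^ nat \<bar>y i\<bar>)" by (simp add: power_sum)
    finally have "16 ^ n * (1 / 2 :: real) ^ (4 * n) \<le> 16 ^ n * (\<Prod>i<n. (1 / 2) ^ nat \<bar>y i\<bar>)"
      by (intro mult_left_mono) auto
    moreover have "(16 :: real) ^ n * (1 / 2) ^ (4 * n) = (16 * (1 / 2) ^ 4) ^ n"
      by (simp only: power_mult power_mult_distrib)
    moreover have "16 * (1 / 2 :: real) ^ 4 = 1" by (simp add: power_divide)
    ultimately show ?thesis by simp
  qed
  have "real (card (int_net n)) = (\<Sum>y\<in>int_net n. 1)" by simp
  also have "\<dots> \<le> (\<Sum>y\<in>int_net n. 16 ^ n * (\<Prod>i<n. (1 / 2 :: real) ^ nat \<bar>y i\<bar>))"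
    by (intro sum_mono one)
  also have "\<dots> \<le> (\<Sum>y\<in>{..<n} \<rightarrow>\<^sub>E ?I. 16 ^ n * (\<Prod>i<n. (1 / 2 :: real) ^ nat \<bar>y i\<bar>))"
  proof (rule sum_mono2[OF _ int_net_subset])
    show "finite ({..<n} \<rightarrow>\<^sub>E ?I)" by (intro finite_PiE) (rule finite_lessThan, rule finite_atLeastAtMost_int)
    show "0 \<le> 16 ^ n * (\<Prod>i<n. (1 / 2 :: real) ^ nat \<bar>y i\<bar>)" for y :: "nat \<Rightarrow> int"
      by (intro mult_nonneg_nonneg prod_nonneg zero_le_power ballI) simp_all
  qed
  also have "\<dots> = 16 ^ n * (\<Prod>i<n. \<Sum>t\<in>?I. (1 / 2 :: real) ^ nat \<bar>t\<bar>)"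
    unfolding sum_distrib_left[symmetric] by (subst prod_sum_PiE) auto
  also have "\<dots> = (16 * (\<Sum>t\<in>?I. (1 / 2 :: real) ^ nat \<bar>t\<bar>)) ^ n"
    by (simp only: prod_constant card_lessThan power_mult_distrib)
  also have "\<dots> \<le> 48 ^ n"
    unfolding sum_half_power_eq
  proof (rule power_mono)
    have *: "q \<le> 1 \<Longrightarrow> 0 \<le> 16 * (3 - 2 * q)" for q :: real by simp
    show "0 \<le> 16 * (3 - 2 * (1 / 2 :: real) ^ (4 * n))" by (rule *, rule power_le_one) auto
  qed simp
  finally show ?thesis .
qed

section \<open>Closed walks and their vertex patterns\<close>

definition walks :: "nat \<Rightarrow> nat \<Rightarrow> nat list set" where
  "walks n m = {w. set w \<subseteq> {..<n} \<and> length w = m}"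

definition walk_weight :: "(nat \<Rightarrow> nat \<Rightarrow> real) \<Rightarrow> nat list \<Rightarrow> real" where
  "walk_weight A w = prod_list (map (\<lambda>(a, b). A a b) (zip w (tl w)))"

text \<open>
  A closed walk of length \<open>m\<close> is stored as the list of its first \<open>m\<close> vertices.
\<close>

definition close :: "nat list \<Rightarrow> nat list" where
  "close w = w @ [hd w]"

text \<open>
  Each step is recorded in increasing order, which is how \<^const>\<open>node_pairs\<close> indexes edges.
\<close>

definition edges :: "nat list \<Rightarrow> (nat \<times> nat) list" where
  "edges w = map (\<lambda>(a, b). (min a b, max a b)) (zip w (tl w))"

definition loopless :: "nat list \<Rightarrow> bool" where
  "loopless w \<longleftrightarrow> (\<forall>(a, b)\<in>set (zip w (tl w)). a \<noteq> b)"

lemma finite_walks [simp]: "finite (walks n m)"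
  using finite_lists_length_eq[of "{..<n}" m] by (simp add: walks_def)

lemma walk_weight_simps [simp]:
  "walk_weight A [] = 1" "walk_weight A [x] = 1"
  "walk_weight A (x # y # zs) = A x y * walk_weight A (y # zs)"
  by (simp_all add: walk_weight_def)

lemma walk_weight_snoc:
  "xs \<noteq> [] \<Longrightarrow> walk_weight A (xs @ [y]) = walk_weight A xs * A (last xs) y"
  by (induction xs rule: induct_list012) auto

lemma sum_walks_Suc: "(\<Sum>w\<in>walks n (Suc m). f w) = (\<Sum>i<n. \<Sum>vs\<in>walks n m. f (i # vs))"
proof -
  have "walks n (Suc m) = (\<lambda>(i, vs). i # vs) ` ({..<n} \<times> walks n m)"
    by (auto simp: walks_def length_Suc_conv image_iff)
  then have "(\<Sum>w\<in>walks n (Suc m). f w) = (\<Sum>(i, vs)\<in>{..<n} \<times> walks n m. f (i # vs))"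
    by (simp add: sum.reindex inj_on_def split_def)
  then show ?thesis by (simp add: sum.cartesian_product)
qed

lemma pow_eq_sum_walks:
  "(app n A ^^ m) x i = (\<Sum>vs\<in>walks n m. walk_weight A (i # vs) * x (last (i # vs)))"
proof (induction m arbitrary: i)
  case 0
  have "walks n 0 = {[]}" by (auto simp: walks_def)
  then show ?case by simp
next
  case (Suc m)
  have "(app n A ^^ Suc m) x i = (\<Sum>j<n. A i j * (app n A ^^ m) x j)" by (simp add: app_def)
  also have "\<dots> = (\<Sum>j<n. \<Sum>vs\<in>walks n m. walk_weight A (i # j # vs) * x (last (i # j # vs)))"
    by (simp add: Suc sum_distrib_left mult.assoc)
  finally show ?case by (simp only: sum_walks_Suc)
qed

lemma trace_pow_eq_sum_walks:
  "trace_pow n A (Suc m) = (\<Sum>w\<in>walks n (Suc m). walk_weight A (close w))"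
proof -
  have "(app n A ^^ Suc m) (unit_at i) i = (\<Sum>vs\<in>walks n m. walk_weight A (close (i # vs)))"
    if "i < n" for i
  proof -
    have "app n A (unit_at i) = (\<lambda>j. A j i)"
      using that by (simp add: fun_eq_iff app_def unit_at_def if_distrib[of "\<lambda>u. _ * u"] sum.delta cong: if_cong)
    then have "(app n A ^^ Suc m) (unit_at i) i = (app n A ^^ m) (\<lambda>j. A j i) i"
      by (simp only: funpow_Suc_right o_apply)
    then show ?thesis
      by (simp add: pow_eq_sum_walks close_def walk_weight_snoc flip: append_Cons)
  qed
  then show ?thesis unfolding trace_pow_def sum_walks_Suc by (intro sum.cong) auto
qed

text \<open>
  Two walks have the same pattern when they agree up to an injective relabelling of vertices.
  The expected weight of a walk in a matrix with independent identically distributed entries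
  depends on the pattern only, and this allows matrices of different sizes to be compared.
\<close>

definition same_pattern :: "nat list \<Rightarrow> nat list \<Rightarrow> bool" where
  "same_pattern u w \<longleftrightarrow> (\<exists>f. inj_on f (set w) \<and> u = map f w)"

lemma same_pattern_sym: "same_pattern u w \<Longrightarrow> same_pattern w u"
proof -
  assume "same_pattern u w"
  then obtain f where f: "inj_on f (set w)" "u = map f w" by (auto simp: same_pattern_def)
  then have "inj_on (inv_into (set w) f) (set u)" "w = map (inv_into (set w) f) u"
    by (auto simp: inj_on_inv_into map_idI)
  then show ?thesis unfolding same_pattern_def by blast
qed

lemma same_pattern_card: "same_pattern u w \<Longrightarrow> card (set u) = card (set w)"
  by (auto simp: same_pattern_def card_image)

lemma card_same_pattern_le:
  "card {u \<in> walks n m. same_pattern u w} \<le> n ^ card (set w)"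
proof -
  have "{u \<in> walks n m. same_pattern u w} \<subseteq> (\<lambda>f. map f w) ` (set w \<rightarrow>\<^sub>E {..<n})"
  proof
    fix u assume "u \<in> {u \<in> walks n m. same_pattern u w}"
    then obtain f where "u = map f w" "set u \<subseteq> {..<n}"
      unfolding same_pattern_def walks_def by blast
    then have "u = map (restrict f (set w)) w" "restrict f (set w) \<in> set w \<rightarrow>\<^sub>E {..<n}" by auto
    then show "u \<in> (\<lambda>f. map f w) ` (set w \<rightarrow>\<^sub>E {..<n})" by blast
  qed
  then have "card {u \<in> walks n m. same_pattern u w} \<le> card (set w \<rightarrow>\<^sub>E {..<n})"
    by (rule surj_card_le[rotated]) (simp add: finite_PiE)
  then show ?thesis by (simp add: card_PiE)
qed

text \<open>
  Each new element of \<open>S\<close> has at least \<open>k\<close> unused values in \<open>T\<close> left.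
\<close>

lemma card_injections_ge:
  assumes "finite S" "finite T" "card S + k \<le> Suc (card T)"
  shows "k ^ card S \<le> card {f \<in> S \<rightarrow>\<^sub>E T. inj_on f S}"
  using assms(1,3)
proof (induction S rule: finite_induct)
  case empty
  then show ?case by simp
next
  case (insert a S)
  let ?F = "{f \<in> S \<rightarrow>\<^sub>E T. inj_on f S}"
  let ?G = "{f \<in> insert a S \<rightarrow>\<^sub>E T. inj_on f (insert a S)}"
  let ?ext = "\<lambda>(f, t). f(a := t)"
  have finF: "finite ?F" using insert(1) assms(2) by (simp add: finite_PiE)
  have finG: "finite ?G" using insert(1) assms(2) by (simp add: finite_PiE)
  have "k ^ card (insert a S) = k ^ card S * k" using insert by simp
  also have "\<dots> \<le> card ?F * k" using insert by (intro mult_right_mono) auto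
  also have "\<dots> = (\<Sum>f\<in>?F. k)" by simp
  also have "\<dots> \<le> (\<Sum>f\<in>?F. card (T - f ` S))"
  proof (rule sum_mono)
    fix f assume "f \<in> ?F"
    then have "card (T - f ` S) = card T - card S"
      using insert(1) by (subst card_Diff_subset) (auto simp: card_image)
    then show "k \<le> card (T - f ` S)" using insert by simp
  qed
  also have "\<dots> = card (SIGMA f:?F. T - f ` S)"
    using finF assms(2) by (subst card_SigmaI) auto
  also have "\<dots> = card (?ext ` (SIGMA f:?F. T - f ` S))"
  proof (rule card_image[symmetric], rule inj_onI, clarify)
    fix f t g s
    assume fg: "f \<in> S \<rightarrow>\<^sub>E T" "g \<in> S \<rightarrow>\<^sub>E T" and eq: "f(a := t) = g(a := s)"
    from eq have "t = s" by (metis fun_upd_same)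
    moreover have "f x = g x" for x
    proof (cases "x = a")
      case True
      then show ?thesis using fg insert(2) by (simp add: PiE_arb[of f S] PiE_arb[of g S])
    next
      case False
      then show ?thesis using eq by (metis fun_upd_other)
    qed
    ultimately show "f = g \<and> t = s" by auto
  qed
  also have "\<dots> \<le> card ?G"
  proof (rule card_mono[OF finG], clarify)
    fix f t assume f: "f \<in> S \<rightarrow>\<^sub>E T" "inj_on f S" "t \<in> T" "t \<notin> f ` S"
    have "f(a := t) \<in> insert a S \<rightarrow>\<^sub>E T" using f by (intro PiE_fun_upd) auto
    moreover have "inj_on (f(a := t)) (insert a S)"
      using f insert(2) by (auto simp: inj_on_def)
    ultimately show "f(a := t) \<in> insert a S \<rightarrow>\<^sub>E T \<and> inj_on (f(a := t)) (insert a S)" ..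
  qed
  finally show ?case .
qed

lemma card_same_pattern_ge:
  assumes "length w = m"
  shows "m ^ card (set w) \<le> card {u \<in> walks (2 * m) m. same_pattern u w}"
proof -
  let ?F = "{f \<in> set w \<rightarrow>\<^sub>E {..<2 * m}. inj_on f (set w)}"
  have "card (set w) \<le> m" using card_length[of w] assms by simp
  then have "m ^ card (set w) \<le> card ?F"
    using card_injections_ge[of "set w" "{..<2 * m}" m] by simp
  also have "\<dots> = card ((\<lambda>f. map f w) ` ?F)"
  proof (rule card_image[symmetric], rule inj_onI)
    fix f g assume "f \<in> ?F" "g \<in> ?F" "map f w = map g w"
    then show "f = g" by (intro extensionalityI[of f "set w"]) (auto simp: PiE_def)
  qed
  also have "\<dots> \<le> card {u \<in> walks (2 * m) m. same_pattern u w}"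
  proof (rule card_mono)
    show "(\<lambda>f. map f w) ` ?F \<subseteq> {u \<in> walks (2 * m) m. same_pattern u w}"
      using assms by (fastforce simp: walks_def same_pattern_def)
  qed simp
  finally show ?thesis .
qed

text \<open>
  A pattern with \<open>v\<close> vertices occurs at most \<open>n ^ v\<close> times among the walks on \<open>n\<close> vertices
  and, since \<open>v \<le> m\<close>, at least \<open>m ^ v\<close> times among those on \<open>2 * m\<close> vertices. The ratio times
  \<open>p ^ (v - 1)\<close> is \<open>(n / m) * (n * p / m) ^ (v - 1) \<le> n / m\<close>. Thus a sparse matrix of any
  size, with about \<open>n * p \<le> m\<close> entries per row, has walk sums no larger, up to the factor
  \<open>n / m\<close>, than those of a dense matrix of size \<open>2 * m\<close>.
\<close>

lemma walk_sum_comparison: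
  fixes H :: "nat list \<Rightarrow> real" and p :: real
  assumes H: "\<And>w. 0 \<le> H w" "\<And>u w. same_pattern u w \<Longrightarrow> H u = H w"
    and m: "0 < m" and p: "0 \<le> p" "n * p \<le> m"
  shows "(\<Sum>w\<in>walks n m. p ^ (card (set w) - 1) * H w) \<le> n / m * (\<Sum>u\<in>walks (2 * m) m. H u)"
proof -
  let ?v = "\<lambda>w::nat list. card (set w)"
  let ?c = "\<lambda>u. p ^ (?v u - 1) * H u / real m ^ ?v u"
  \<comment> \<open>distribute the term of \<open>w\<close> over the large walks with its pattern, then exchange the sums\<close>
  have "(\<Sum>w\<in>walks n m. p ^ (?v w - 1) * H w)
      \<le> (\<Sum>w\<in>walks n m. \<Sum>u\<in>{u \<in> walks (2 * m) m. same_pattern u w}. ?c u)"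
  proof (rule sum_mono)
    fix w assume "w \<in> walks n m"
    then have "m ^ ?v w \<le> card {u \<in> walks (2 * m) m. same_pattern u w}"
      by (intro card_same_pattern_ge) (simp add: walks_def)
    then have "real m ^ ?v w \<le> card {u \<in> walks (2 * m) m. same_pattern u w}"
      by (metis of_nat_le_iff of_nat_power)
    then have "real m ^ ?v w * ?c w \<le> card {u \<in> walks (2 * m) m. same_pattern u w} * ?c w"
      using p H by (intro mult_right_mono) auto
    also have "\<dots> = (\<Sum>u\<in>{u \<in> walks (2 * m) m. same_pattern u w}. ?c u)"
    proof -
      have "?c u = ?c w" if "same_pattern u w" for u
        using H(2)[OF that] same_pattern_card[OF that] by simp
      then show ?thesis by simp
    qed
    finally show "p ^ (?v w - 1) * H w \<le> (\<Sum>u\<in>{u \<in> walks (2 * m) m. same_pattern u w}. ?c u)"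
      using m by simp
  qed
  also have "\<dots> = (\<Sum>u\<in>walks (2 * m) m. \<Sum>w\<in>{w \<in> walks n m. same_pattern u w}. ?c u)"
    by (rule sum.swap_restrict) simp_all
  also have "\<dots> \<le> (\<Sum>u\<in>walks (2 * m) m. n / m * H u)"
  proof (rule sum_mono)
    fix u assume u: "u \<in> walks (2 * m) m"
    then have "u \<noteq> []" using m by (auto simp: walks_def)
    then obtain k where k: "?v u = Suc k" by (metis List.finite_set card_gt_0_iff gr0_implies_Suc set_empty)
    have "{w \<in> walks n m. same_pattern u w} = {w \<in> walks n m. same_pattern w u}"
      using same_pattern_sym by blast
    then have "card {w \<in> walks n m. same_pattern u w} \<le> n ^ ?v u"
      using card_same_pattern_le[of n m u] by simp
    then have "real (card {w \<in> walks n m. same_pattern u w}) \<le> real n ^ ?v u"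
      by (metis of_nat_le_iff of_nat_power)
    then have "(\<Sum>w\<in>{w \<in> walks n m. same_pattern u w}. ?c u) \<le> real n ^ ?v u * ?c u"
      using p H by (simp only: sum_constant) (intro mult_right_mono, auto)
    also have "\<dots> = (n * p / m) ^ k * (n / m * H u)"
      by (simp add: k power_mult_distrib power_divide mult_ac)
    also have "\<dots> \<le> 1 * (n / m * H u)"
      using p m H by (intro mult_right_mono power_le_one) (auto simp: field_simps)
    finally show "(\<Sum>w\<in>{w \<in> walks n m. same_pattern u w}. ?c u) \<le> n / m * H u" by simp
  qed
  finally show ?thesis by (simp add: sum_distrib_left)
qed

text \<open>
  A walk is connected: each vertex visited for the first time is reached along a new edge.
\<close>

lemma card_vertices_le_edges: "card (set w) \<le> card (set (edges w)) + 1"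
proof (induction w rule: induct_list012)
  case (3 x y zs)
  have eq: "edges (x # y # zs) = (min x y, max x y) # edges (y # zs)" by (simp add: edges_def)
  show ?case
  proof (cases "x \<in> set (y # zs)")
    case True
    then have "card (set (x # y # zs)) = card (set (y # zs))" by (simp add: insert_absorb)
    also have "\<dots> \<le> card (set (edges (y # zs))) + 1" by (rule 3(2))
    also have "\<dots> \<le> card (set (edges (x # y # zs))) + 1"
      unfolding eq by (intro add_right_mono card_mono) auto
    finally show ?thesis .
  next
    case False
    have "(min x y, max x y) \<notin> set (edges (y # zs))"
    proof
      assume "(min x y, max x y) \<in> set (edges (y # zs))"
      then obtain a b where "(a, b) \<in> set (zip (y # zs) zs)"
        "min x y = min a b" "max x y = max a b" by (auto simp: edges_def)
      then have "x = a \<or> x = b" "a \<in> set (y # zs)" "b \<in> set (y # zs)"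
        by (auto simp: min_def max_def split: if_splits dest: set_zip_leftD set_zip_rightD)
      with False show False by auto
    qed
    with 3(2) False show ?thesis unfolding eq by (simp add: card_insert_if)
  qed
qed (simp_all add: edges_def)

text \<open>
  The expected weight of \<open>w\<close> in a symmetric matrix with zero diagonal whose entries above the
  diagonal are independent with \<open>k\<close>-th moment \<open>\<mu> k\<close>.
\<close>

definition pattern_moment :: "(nat \<Rightarrow> real) \<Rightarrow> nat list \<Rightarrow> real" where
  "pattern_moment \<mu> w =
    (if loopless w then \<Prod>e\<in>set (edges w). \<mu> (count_list (edges w) e) else 0)"

lemma count_list_map_inj:
  "inj_on h (set L) \<Longrightarrow> e \<in> set L \<Longrightarrow> count_list (map h L) (h e) = count_list L e"
proof -
  assume inj: "inj_on h (set L)" and e: "e \<in> set L"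
  have "set M \<subseteq> set L \<Longrightarrow> count_list (map h M) (h e) = count_list M e" for M
    using inj e by (induction M) (auto simp: inj_on_def)
  then show ?thesis by simp
qed

lemma pattern_moment_same_pattern:
  assumes "same_pattern u w"
  shows "pattern_moment \<mu> u = pattern_moment \<mu> w"
proof -
  obtain f where f: "inj_on f (set w)" "u = map f w" using assms by (auto simp: same_pattern_def)
  let ?n = "\<lambda>(a, b). (min a b :: nat, max a b)"
  define h where "h = (\<lambda>e. ?n (map_prod f f e))"
  have zip: "zip u (tl u) = map (map_prod f f) (zip w (tl w))"
    by (simp add: f zip_map_map map_prod_def flip: map_tl)
  have mem: "a \<in> set w" "b \<in> set w" if "(a, b) \<in> set (zip w (tl w))" for a b
    using that by (auto dest: set_zip_leftD) (metis set_zip_rightD list.set_sel(2) tl_Nil)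
  have edges_eq: "edges u = map h (edges w)"
    by (auto simp: edges_def zip h_def min_def max_def)
  have mem': "a \<in> set w" "b \<in> set w" "a \<le> b" if "(a, b) \<in> set (edges w)" for a b
    using that mem by (auto simp: edges_def min_def max_def split: if_splits)
  have "inj_on h (set (edges w))"
  proof (rule inj_onI, clarify)
    fix a b c d assume ab: "(a, b) \<in> set (edges w)" and cd: "(c, d) \<in> set (edges w)"
      and "h (a, b) = h (c, d)"
    then have "f a = f c \<and> f b = f d \<or> f a = f d \<and> f b = f c"
      by (auto simp: h_def min_def max_def split: if_splits)
    then have "a = c \<and> b = d \<or> a = d \<and> b = c"
      using f(1) mem'[OF ab] mem'[OF cd] by (auto simp: inj_on_def)
    then show "a = c \<and> b = d" using mem'[OF ab] mem'[OF cd] by auto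
  qed
  moreover have "loopless u \<longleftrightarrow> loopless w"
    using f(1) mem unfolding loopless_def zip by (auto simp: inj_on_eq_iff)
  ultimately show ?thesis
    by (simp add: pattern_moment_def edges_eq prod.reindex count_list_map_inj)
qed

lemma same_pattern_close:
  assumes "same_pattern u w" "w \<noteq> []"
  shows "same_pattern (close u) (close w)"
proof -
  obtain f where f: "inj_on f (set w)" "u = map f w" using assms by (auto simp: same_pattern_def)
  then have "inj_on f (set (close w)) \<and> close u = map f (close w)"
    using assms by (simp add: close_def hd_map insert_absorb)
  then show ?thesis unfolding same_pattern_def by blast
qed

section \<open>Random symmetric matrices\<close>

definition symm :: "(nat \<times> nat \<Rightarrow> real) \<Rightarrow> nat \<Rightarrow> nat \<Rightarrow> real" where
  "symm x i j = (if i < j then x (i, j) else if j < i then x (j, i) else 0)"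

abbreviation iid_pairs :: "nat \<Rightarrow> real pmf \<Rightarrow> (nat \<times> nat \<Rightarrow> real) pmf" where
  "iid_pairs n \<nu> \<equiv> Pi_pmf (node_pairs n) 0 (\<lambda>_. \<nu>)"

lemma symm_commute: "symm x i j = symm x j i"
  by (simp add: symm_def)

lemma finite_node_pairs [simp]: "finite (node_pairs n)"
proof (rule finite_subset)
  show "node_pairs n \<subseteq> {..<n} \<times> {..<n}" by (auto simp: node_pairs_def)
qed simp

lemma sum_node_pairs:
  fixes g :: "nat \<Rightarrow> nat \<Rightarrow> real"
  assumes "\<And>i. g i i = 0"
  shows "(\<Sum>i<n. \<Sum>j<n. g i j) = (\<Sum>(i, j)\<in>node_pairs n. g i j + g j i)"
proof -
  let ?N = "node_pairs n" and ?D = "(\<lambda>i. (i, i)) ` {..<n}"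
  have split: "{..<n} \<times> {..<n} = ?N \<union> prod.swap ` ?N \<union> ?D"
    by (auto simp: node_pairs_def image_iff)
  have "(\<Sum>i<n. \<Sum>j<n. g i j) = (\<Sum>(i, j)\<in>?N \<union> prod.swap ` ?N \<union> ?D. g i j)"
    by (simp add: sum.cartesian_product flip: split)
  also have "\<dots> = (\<Sum>(i, j)\<in>?N \<union> prod.swap ` ?N. g i j) + (\<Sum>(i, j)\<in>?D. g i j)"
    by (intro sum.union_disjoint) (simp_all, auto simp: node_pairs_def)
  also have "(\<Sum>(i, j)\<in>?D. g i j) = 0" using assms by (intro sum.neutral) auto
  also have "(\<Sum>(i, j)\<in>?N \<union> prod.swap ` ?N. g i j) = (\<Sum>(i, j)\<in>?N. g i j) + (\<Sum>(i, j)\<in>prod.swap ` ?N. g i j)"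
    by (intro sum.union_disjoint) (simp_all, auto simp: node_pairs_def)
  also have "(\<Sum>(i, j)\<in>prod.swap ` ?N. g i j) = (\<Sum>(i, j)\<in>?N. g j i)"
    by (subst sum.reindex) (auto simp: split_def)
  finally show ?thesis by (simp add: sum.distrib split_def)
qed

lemma finite_set_iid_pairs: "finite (set_pmf \<nu>) \<Longrightarrow> finite (set_pmf (iid_pairs n \<nu>))"
  by (rule finite_subset[OF set_Pi_pmf_subset']) (auto intro: finite_PiE_dflt)

lemma expectation_prod_iid_pairs:
  fixes f :: "nat \<times> nat \<Rightarrow> real \<Rightarrow> real"
  assumes fin: "finite (set_pmf \<nu>)"
  shows "measure_pmf.expectation (iid_pairs n \<nu>) (\<lambda>x. \<Prod>e\<in>node_pairs n. f e (x e))
    = (\<Prod>e\<in>node_pairs n. measure_pmf.expectation \<nu> (f e))"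
proof -
  let ?M = "iid_pairs n \<nu>"
  have "measure_pmf.expectation ?M (\<lambda>x. \<Prod>e\<in>node_pairs n. f e (x e))
      = (\<Prod>e\<in>node_pairs n. measure_pmf.expectation ?M (\<lambda>x. f e (x e)))"
  proof (rule prob_space.indep_vars_lebesgue_integral[OF measure_pmf.prob_space_axioms])
    show "prob_space.indep_vars ?M (\<lambda>_. borel) (\<lambda>e x. f e (x e)) (node_pairs n)"
      by (rule prob_space.indep_vars_compose2[OF measure_pmf.prob_space_axioms indep_vars_Pi_pmf]) auto
  qed (auto intro!: integrable_measure_pmf_finite finite_set_iid_pairs fin)
  also have "\<dots> = (\<Prod>e\<in>node_pairs n. measure_pmf.expectation \<nu> (f e))"
  proof (rule prod.cong[OF refl])
    fix e assume "e \<in> node_pairs n"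
    then have "map_pmf (\<lambda>x. x e) ?M = \<nu>" by (simp add: Pi_pmf_component)
    then show "measure_pmf.expectation ?M (\<lambda>x. f e (x e)) = measure_pmf.expectation \<nu> (f e)"
      by (metis integral_map_pmf)
  qed
  finally show ?thesis .
qed

lemma prod_list_map_eq_prod_count:
  fixes f :: "'a \<Rightarrow> real"
  shows "set L \<subseteq> X \<Longrightarrow> finite X \<Longrightarrow> prod_list (map f L) = (\<Prod>e\<in>X. f e ^ count_list L e)"
proof (induction L)
  case (Cons a L)
  have "(\<Prod>e\<in>X. f e ^ count_list (a # L) e) = (\<Prod>e\<in>X. (if e = a then f e else 1) * f e ^ count_list L e)"
    by (intro prod.cong) auto
  also have "\<dots> = f a * (\<Prod>e\<in>X. f e ^ count_list L e)"
    using Cons.prems by (simp add: prod.distrib prod.delta)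
  finally show ?case using Cons by simp
qed simp

text \<open>
  Collecting equal edges turns the weight into a product of powers of independent entries. A
  walk with a loop meets the zero diagonal.
\<close>

lemma expectation_walk_weight:
  assumes fin: "finite (set_pmf \<nu>)" and w: "set w \<subseteq> {..<n}"
  shows "measure_pmf.expectation (iid_pairs n \<nu>) (\<lambda>x. walk_weight (symm (\<lambda>e. f (x e))) w)
    = pattern_moment (\<lambda>k. measure_pmf.expectation \<nu> (\<lambda>v. f v ^ k)) w"
proof (cases "loopless w")
  case False
  then obtain a where "(a, a) \<in> set (zip w (tl w))" by (auto simp: loopless_def)
  then have "walk_weight (symm y) w = 0" for y
    unfolding walk_weight_def by (intro prod_list_zero_iff[THEN iffD2]) (force simp: symm_def)
  then show ?thesis using False by (simp add: pattern_moment_def)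
next
  case True
  have mem: "a < n" "b < n" "a \<noteq> b" if "(a, b) \<in> set (zip w (tl w))" for a b
    using that w True by (auto simp: loopless_def dest: set_zip_leftD)
      (metis set_zip_rightD list.set_sel(2) tl_Nil lessThan_iff subsetD)
  then have sub: "set (edges w) \<subseteq> node_pairs n"
    by (fastforce simp: edges_def node_pairs_def min_def max_def)
  have "walk_weight (symm y) w = prod_list (map y (edges w))" for y
    unfolding walk_weight_def edges_def using mem
    by (auto intro!: arg_cong[of _ _ prod_list] simp: symm_def min_def max_def)
  then have "walk_weight (symm (\<lambda>e. f (x e))) w = (\<Prod>e\<in>node_pairs n. f (x e) ^ count_list (edges w) e)" for x
    using prod_list_map_eq_prod_count[OF sub finite_node_pairs] by simp
  then have "measure_pmf.expectation (iid_pairs n \<nu>) (\<lambda>x. walk_weight (symm (\<lambda>e. f (x e))) w)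
      = (\<Prod>e\<in>node_pairs n. measure_pmf.expectation \<nu> (\<lambda>v. f v ^ count_list (edges w) e))"
    using expectation_prod_iid_pairs[OF fin, of n "\<lambda>e v. f v ^ count_list (edges w) e"] by simp
  also have "\<dots> = (\<Prod>e\<in>set (edges w). measure_pmf.expectation \<nu> (\<lambda>v. f v ^ count_list (edges w) e))"
    using sub by (intro prod.mono_neutral_right) (auto simp: count_list_0_iff)
  finally show ?thesis using True by (simp add: pattern_moment_def)
qed

lemma expectation_trace_pow:
  assumes fin: "finite (set_pmf \<nu>)" and m: "0 < m"
  shows "measure_pmf.expectation (iid_pairs n \<nu>) (\<lambda>x. trace_pow n (symm (\<lambda>e. f (x e))) m)
    = (\<Sum>w\<in>walks n m. pattern_moment (\<lambda>k. measure_pmf.expectation \<nu> (\<lambda>v. f v ^ k)) (close w))"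
proof -
  obtain m' where m': "m = Suc m'" using m by (cases m) auto
  have "measure_pmf.expectation (iid_pairs n \<nu>) (\<lambda>x. trace_pow n (symm (\<lambda>e. f (x e))) m)
    = (\<Sum>w\<in>walks n m. measure_pmf.expectation (iid_pairs n \<nu>) (\<lambda>x. walk_weight (symm (\<lambda>e. f (x e))) (close w)))"
    unfolding m' trace_pow_eq_sum_walks
    by (intro Bochner_Integration.integral_sum integrable_measure_pmf_finite finite_set_iid_pairs fin)
  also have "\<dots> = (\<Sum>w\<in>walks n m. pattern_moment (\<lambda>k. measure_pmf.expectation \<nu> (\<lambda>v. f v ^ k)) (close w))"
  proof (intro sum.cong refl expectation_walk_weight fin)
    fix w assume "w \<in> walks n m"
    then show "set (close w) \<subseteq> {..<n}"
      using m by (cases w) (auto simp: walks_def close_def)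
  qed
  finally show ?thesis .
qed

section \<open>A dense comparison matrix\<close>

text \<open>
  The entry law of the comparison matrix: centred, bounded, and with \<open>k\<close>-th moment at least
  \<open>2 ^ (k - 2)\<close> for all \<open>k \<ge> 2\<close>. The asymmetry makes the odd moments positive: those of the
  noise do not vanish and must be dominated too.
\<close>

definition skew_pmf :: "real pmf" where
  "skew_pmf = map_pmf (\<lambda>b. if b then 2 else -1) (bernoulli_pmf (1 / 3))"

lemma expectation_skew: "measure_pmf.expectation skew_pmf f = (f 2 + 2 * f (- 1)) / 3"
  for f :: "real \<Rightarrow> real"
  by (simp add: skew_pmf_def field_simps)

lemma finite_skew [simp]: "finite (set_pmf skew_pmf)"
  by (simp add: skew_pmf_def)

lemma skew_moment_ge:
  assumes "2 \<le> k"
  shows "2 ^ (k - 2) \<le> measure_pmf.expectation skew_pmf (\<lambda>v. v ^ k)"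
proof -
  obtain l where k: "k = l + 2" using assms by (metis add.commute le_Suc_ex)
  have "- 1 \<le> (- 1 :: real) ^ l" by (cases "even l") auto
  moreover have "l = 0 \<or> 2 \<le> (2 :: real) ^ l"
    by (cases l) (auto simp: one_le_power)
  ultimately show ?thesis by (auto simp: expectation_skew k power_add)
qed

lemma skew_moment_nonneg: "0 \<le> measure_pmf.expectation skew_pmf (\<lambda>v. v ^ k)"
proof -
  consider "k = 0" | "k = 1" | "2 \<le> k" by linarith
  then show ?thesis
  proof cases
    case 3
    then show ?thesis using skew_moment_ge[of k] by (meson order_trans zero_le_numeral zero_le_power)
  qed (simp_all add: expectation_skew)
qed

text \<open>
  This is Hoeffding's lemma for a two-point law, the interval having length 3; negative \<open>t\<close>
  exchanges the roles of the two points.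
\<close>

lemma skew_mgf: "measure_pmf.expectation skew_pmf (\<lambda>v. exp (t * v)) \<le> exp (9 * t\<^sup>2 / 8)"
proof (cases "0 \<le> t")
  case True
  then have "1 \<le> exp (3 * t)" by simp
  then have pos: "0 < 1 + 1 / 3 * (exp (3 * t) - 1)"
    by (intro add_pos_nonneg mult_nonneg_nonneg) simp_all
  have prod: "exp (t * 2) = exp (- t) * exp (3 * t)" by (simp flip: exp_add)
  have "measure_pmf.expectation skew_pmf (\<lambda>v. exp (t * v)) = exp (- t) * (1 + 1 / 3 * (exp (3 * t) - 1))"
    unfolding expectation_skew prod by (simp add: field_simps)
  also have "\<dots> = exp (- (3 * t) * (1 / 3) + ln (1 + 1 / 3 * (exp (3 * t) - 1)))"
    unfolding exp_add exp_ln[OF pos] by simp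
  also have "\<dots> \<le> exp ((3 * t)\<^sup>2 / 8)"
    unfolding exp_le_cancel_iff using True by (intro Hoeffdings_lemma_aux) auto
  finally show ?thesis by (simp add: power_mult_distrib)
next
  case False
  then have "1 \<le> exp (- 3 * t)" by simp
  then have pos: "0 < 1 + 2 / 3 * (exp (- 3 * t) - 1)"
    by (intro add_pos_nonneg mult_nonneg_nonneg) simp_all
  have prod: "exp (t * - 1) = exp (2 * t) * exp (- 3 * t)" by (simp flip: exp_add)
  have "measure_pmf.expectation skew_pmf (\<lambda>v. exp (t * v)) = exp (2 * t) * (1 + 2 / 3 * (exp (- 3 * t) - 1))"
    unfolding expectation_skew prod by (simp add: field_simps)
  also have "\<dots> = exp (- (- 3 * t) * (2 / 3) + ln (1 + 2 / 3 * (exp (- 3 * t) - 1)))"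
    unfolding exp_add exp_ln[OF pos] by simp
  also have "\<dots> \<le> exp ((- 3 * t)\<^sup>2 / 8)"
    unfolding exp_le_cancel_iff using False by (intro Hoeffdings_lemma_aux) auto
  finally show ?thesis by (simp add: power_mult_distrib)
qed

text \<open>
  From \<open>y \<le> exp y\<close> at \<open>y = \<bar>s\<bar> / m\<close>.
\<close>

lemma power_le_exp_abs:
  assumes "0 < m" shows "\<bar>s\<bar> ^ m \<le> real m ^ m * (exp s + exp (- s))"
proof -
  have "\<bar>s\<bar> / m \<le> exp (\<bar>s\<bar> / m)" using exp_ge_add_one_self[of "\<bar>s\<bar> / m"] by linarith
  then have "(\<bar>s\<bar> / m) ^ m \<le> exp (\<bar>s\<bar> / m) ^ m" by (intro power_mono) auto
  also have "\<dots> = exp \<bar>s\<bar>" using assms by (simp flip: exp_of_nat_mult)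
  also have "\<dots> \<le> exp s + exp (- s)" by (cases "0 \<le> s") auto
  finally show ?thesis using assms by (simp add: power_divide field_simps)
qed

text \<open>
  A Khintchine inequality: an even power is bounded by exponentials \<open>exp (\<plusminus> l * S)\<close>, whose
  expectations are sub-Gaussian.
\<close>

lemma skew_sum_moment:
  assumes k: "0 < k" and V: "0 < V" "(\<Sum>e\<in>node_pairs n. (a e)\<^sup>2) \<le> V"
  shows "measure_pmf.expectation (iid_pairs n skew_pmf) (\<lambda>x. (\<Sum>e\<in>node_pairs n. a e * x e) ^ (2 * k))
    \<le> 2 * (2 * exp (9 / 4) * k * V) ^ k"
proof -
  let ?M = "iid_pairs n skew_pmf" and ?m = "2 * k"
  define S where "S = (\<lambda>x. \<Sum>e\<in>node_pairs n. a e * x e)"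
  \<comment> \<open>of the order of the rate that balances \<open>l ^ (- 2 * k)\<close> against \<open>exp (l\<^sup>2 * V)\<close>\<close>
  define l where "l = sqrt (?m / V)"
  have l: "0 < l" "l\<^sup>2 = ?m / V" using k V by (simp_all add: l_def)
  have int: "integrable ?M g" for g :: "(nat \<times> nat \<Rightarrow> real) \<Rightarrow> real"
    by (intro integrable_measure_pmf_finite finite_set_iid_pairs) simp
  have mgf: "measure_pmf.expectation ?M (\<lambda>x. exp (t * S x)) \<le> exp (9 / 4 * k)" if t: "t\<^sup>2 = l\<^sup>2" for t
  proof -
    have "exp (t * S x) = (\<Prod>e\<in>node_pairs n. exp (t * a e * x e))" for x
      by (simp add: S_def sum_distrib_left exp_sum mult.assoc)
    then have "measure_pmf.expectation ?M (\<lambda>x. exp (t * S x))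
        = (\<Prod>e\<in>node_pairs n. measure_pmf.expectation skew_pmf (\<lambda>v. exp (t * a e * v)))"
      using expectation_prod_iid_pairs[OF finite_skew, of n "\<lambda>e v. exp (t * a e * v)"] by simp
    also have "\<dots> \<le> (\<Prod>e\<in>node_pairs n. exp (9 * (t * a e)\<^sup>2 / 8))"
      by (intro prod_mono conjI skew_mgf integral_nonneg) auto
    also have "\<dots> = exp (9 / 8 * t\<^sup>2 * (\<Sum>e\<in>node_pairs n. (a e)\<^sup>2))"
      by (simp add: power_mult_distrib sum_distrib_left mult_ac flip: exp_sum)
    also have "\<dots> \<le> exp (9 / 8 * t\<^sup>2 * V)" using V by (auto intro: mult_left_mono)
    also have "9 / 8 * t\<^sup>2 * V = 9 / 4 * k" using V by (simp add: t l)
    finally show ?thesis .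
  qed
  have pt: "S x ^ ?m \<le> (?m / l) ^ ?m * (exp (l * S x) + exp (- l * S x))" for x
  proof -
    have "\<bar>l * S x\<bar> ^ ?m \<le> real ?m ^ ?m * (exp (l * S x) + exp (- (l * S x)))"
      using k by (intro power_le_exp_abs) simp
    also have "\<bar>l * S x\<bar> ^ ?m = l ^ ?m * S x ^ ?m"
      by (simp add: abs_mult power_mult_distrib power_mult)
    finally show ?thesis using l by (simp add: power_divide field_simps)
  qed
  have "measure_pmf.expectation ?M (\<lambda>x. S x ^ ?m)
      \<le> measure_pmf.expectation ?M (\<lambda>x. (?m / l) ^ ?m * (exp (l * S x) + exp (- l * S x)))"
    by (intro integral_mono int pt)
  also have "\<dots> = (?m / l) ^ ?m * (measure_pmf.expectation ?M (\<lambda>x. exp (l * S x))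
      + measure_pmf.expectation ?M (\<lambda>x. exp (- l * S x)))"
    by (simp add: int)
  also have "\<dots> \<le> (?m / l) ^ ?m * (exp (9 / 4 * k) + exp (9 / 4 * k))"
    using mgf[of l] mgf[of "- l"] l by (intro mult_left_mono add_mono) simp_all
  also have "(?m / l) ^ ?m = (?m * V) ^ k"
  proof -
    have "(?m / l) ^ ?m = ((?m / l)\<^sup>2) ^ k" by (simp add: power_mult)
    also have "(?m / l)\<^sup>2 = ?m * V" using k V by (simp add: power_divide l) (simp add: power2_eq_square)
    finally show ?thesis .
  qed
  also have "exp (9 / 4 * k) = exp (9 / 4) ^ k" by (simp add: mult.commute flip: exp_of_nat_mult)
  also have "(?m * V) ^ k * (exp (9 / 4) ^ k + exp (9 / 4) ^ k) = 2 * (2 * exp (9 / 4) * k * V) ^ k"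
    by (simp add: power_mult_distrib algebra_simps)
  finally show ?thesis by (simp add: S_def)
qed

lemma trace_pow_le_int_net:
  assumes sym: "\<And>i j. i < r \<Longrightarrow> j < r \<Longrightarrow> A i j = A j i" and r: "0 < r"
  shows "trace_pow r A (2 * k) \<le> r * (\<Sum>u\<in>int_net r. \<Sum>v\<in>int_net r.
    (dot r (\<lambda>i. real_of_int (u i)) (app r A (\<lambda>i. real_of_int (v i))) / r) ^ (2 * k))"
proof -
  let ?g = "\<lambda>(u, v). dot r (\<lambda>i. real_of_int (u i)) (app r A (\<lambda>i. real_of_int (v i))) / r"
  let ?N = "int_net r \<times> int_net r"
  define B where "B = Max (?g ` ?N)"
  have "(\<lambda>i\<in>{..<r}. 0) \<in> int_net r" by (simp add: int_net_def)
  then have ne: "?g ` ?N \<noteq> {}" by auto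
  have fin: "finite (?g ` ?N)" by simp
  have "trace_pow r A (2 * k) \<le> r * B ^ (2 * k)"
  proof (rule trace_pow_le[OF sym])
    fix x y :: "nat \<Rightarrow> real" assume xy: "dot r x x \<le> 1" "dot r y y \<le> 1"
    obtain u v where uv: "u \<in> int_net r" "v \<in> int_net r"
      "r * dot r y (app r A x) \<le> dot r (\<lambda>i. real_of_int (u i)) (app r A (\<lambda>i. real_of_int (v i)))"
      by (rule bilinear_le_int_net[of r A x y, OF sym xy])
    then have "dot r y (app r A x) \<le> ?g (u, v)" using r by (simp add: field_simps)
    also have "\<dots> \<le> B" unfolding B_def using uv by (intro Max_ge fin) blast
    finally show "dot r y (app r A x) \<le> B" .
  qed
  also have "r * B ^ (2 * k) \<le> r * (\<Sum>e\<in>?N. ?g e ^ (2 * k))"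
  proof -
    obtain e where e: "e \<in> ?N" "B = ?g e" using Max_in[OF fin ne] by (auto simp: B_def)
    have "?g e ^ (2 * k) \<le> (\<Sum>e\<in>?N. ?g e ^ (2 * k))"
      using e by (intro member_le_sum) (auto simp: power_mult)
    then show ?thesis using e by (intro mult_left_mono) auto
  qed
  finally show ?thesis by (simp add: sum.cartesian_product split_def)
qed

lemma dot_app_symm:
  "dot n u (app n (symm x) v) = (\<Sum>e\<in>node_pairs n. (u (fst e) * v (snd e) + u (snd e) * v (fst e)) * x e)"
proof -
  have "dot n u (app n (symm x) v) = (\<Sum>i<n. \<Sum>j<n. u i * symm x i j * v j)"
    by (simp add: dot_def app_def sum_distrib_left mult_ac)
  also have "\<dots> = (\<Sum>(i, j)\<in>node_pairs n. u i * symm x i j * v j + u j * symm x j i * v i)"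
    by (rule sum_node_pairs) (simp add: symm_def)
  also have "\<dots> = (\<Sum>e\<in>node_pairs n. (u (fst e) * v (snd e) + u (snd e) * v (fst e)) * x e)"
    by (intro sum.cong) (auto simp: node_pairs_def symm_def algebra_simps)
  finally show ?thesis .
qed

lemma sum_coefficients_le:
  "(\<Sum>e\<in>node_pairs n. (u (fst e) * v (snd e) + u (snd e) * v (fst e))\<^sup>2) \<le> 2 * dot n u u * dot n v v"
proof -
  let ?g = "\<lambda>i j. if i = j then 0 else 2 * ((u i)\<^sup>2 * (v j)\<^sup>2)"
  have "(\<Sum>e\<in>node_pairs n. (u (fst e) * v (snd e) + u (snd e) * v (fst e))\<^sup>2)
      \<le> (\<Sum>(i, j)\<in>node_pairs n. ?g i j + ?g j i)"
  proof (rule sum_mono, clarify)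
    fix i j assume "(i, j) \<in> node_pairs n"
    then have "i \<noteq> j" by (simp add: node_pairs_def)
    moreover have "(u i * v j + u j * v i)\<^sup>2 \<le> 2 * (u i * v j)\<^sup>2 + 2 * (u j * v i)\<^sup>2"
      using sum_squares_bound[of "u i * v j" "u j * v i"] by (simp add: power2_sum)
    ultimately show "(u (fst (i, j)) * v (snd (i, j)) + u (snd (i, j)) * v (fst (i, j)))\<^sup>2 \<le> ?g i j + ?g j i"
      by (simp add: power_mult_distrib mult.commute)
  qed
  also have "\<dots> = (\<Sum>i<n. \<Sum>j<n. ?g i j)" by (rule sum_node_pairs[symmetric]) simp
  also have "\<dots> \<le> (\<Sum>i<n. \<Sum>j<n. 2 * ((u i)\<^sup>2 * (v j)\<^sup>2))" by (intro sum_mono) auto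
  also have "\<dots> = 2 * dot n u u * dot n v v"
    by (simp add: dot_def power2_eq_square sum_product sum_distrib_left mult_ac)
  finally show ?thesis .
qed

text \<open>
  The dense matrix has size \<open>r = 4 * k\<close> proportional to the order \<open>2 * k\<close> of the moment, so the
  \<open>48 ^ (2 * r)\<close> pairs of integer vectors cost only a constant factor per power: the operator
  norm is of order \<open>sqrt k\<close>, with no logarithmic loss.
\<close>

lemma expectation_trace_pow_skew:
  assumes k: "0 < k"
  shows "measure_pmf.expectation (iid_pairs (4 * k) skew_pmf) (\<lambda>x. trace_pow (4 * k) (symm x) (2 * k))
    \<le> 8 * k * (48 ^ 8 * 64 * exp (9 / 4) * k) ^ k"
proof -
  define r where "r = 4 * k"
  have r: "0 < r" using k by (simp add: r_def)
  let ?M = "iid_pairs r skew_pmf" and ?N = "int_net r"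
  let ?b = "\<lambda>x u v. dot r (\<lambda>i. real_of_int (u i)) (app r (symm x) (\<lambda>i. real_of_int (v i)))"
  have int: "integrable ?M g" for g :: "(nat \<times> nat \<Rightarrow> real) \<Rightarrow> real"
    by (intro integrable_measure_pmf_finite finite_set_iid_pairs) simp
  have net: "dot r (\<lambda>i. real_of_int (u i)) (\<lambda>i. real_of_int (u i)) \<le> 4 * real r" if "u \<in> ?N" for u
  proof -
    have "(\<Sum>i<r. (u i)\<^sup>2) \<le> 4 * int r" using that by (simp add: int_net_def)
    then have "real_of_int (\<Sum>i<r. (u i)\<^sup>2) \<le> real_of_int (4 * int r)" by (simp only: of_int_le_iff)
    then show ?thesis by (simp add: dot_def power2_eq_square)
  qed
  have one: "measure_pmf.expectation ?M (\<lambda>x. (?b x u v / r) ^ (2 * k)) \<le> 2 * (64 * exp (9 / 4) * k) ^ k"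
    if uv: "u \<in> ?N" "v \<in> ?N" for u v
  proof -
    let ?u = "\<lambda>i. real_of_int (u i)" and ?v = "\<lambda>i. real_of_int (v i)"
    have "(\<Sum>e\<in>node_pairs r. (?u (fst e) * ?v (snd e) + ?u (snd e) * ?v (fst e))\<^sup>2)
        \<le> 2 * dot r ?u ?u * dot r ?v ?v" by (rule sum_coefficients_le)
    also have "\<dots> \<le> 2 * (4 * real r) * (4 * real r)"
      by (intro mult_mono net uv) (auto intro!: mult_nonneg_nonneg simp: dot_self_nonneg)
    also have "\<dots> = 32 * (real r)\<^sup>2" by (simp add: power2_eq_square)
    finally have "measure_pmf.expectation ?M (\<lambda>x. ?b x u v ^ (2 * k)) \<le> 2 * (2 * exp (9 / 4) * k * (32 * (real r)\<^sup>2)) ^ k"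
      unfolding dot_app_symm using k r by (intro skew_sum_moment) auto
    also have "\<dots> = 2 * (64 * exp (9 / 4) * k) ^ k * real r ^ (2 * k)"
    proof -
      have eq: "2 * exp (9 / 4) * k * (32 * (real r)\<^sup>2) = (64 * exp (9 / 4) * k) * (real r)\<^sup>2" by simp
      show ?thesis
        unfolding eq power_mult_distrib[of _ "(real r)\<^sup>2"] power_mult by (simp only: mult_ac)
    qed
    finally show ?thesis using r by (simp add: power_divide field_simps)
  qed
  have "measure_pmf.expectation ?M (\<lambda>x. trace_pow r (symm x) (2 * k))
      \<le> measure_pmf.expectation ?M (\<lambda>x. r * (\<Sum>u\<in>?N. \<Sum>v\<in>?N. (?b x u v / r) ^ (2 * k)))"
    using symm_commute r by (intro integral_mono int trace_pow_le_int_net) blast+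
  also have "\<dots> = r * (\<Sum>u\<in>?N. \<Sum>v\<in>?N. measure_pmf.expectation ?M (\<lambda>x. (?b x u v / r) ^ (2 * k)))"
    by (simp add: int Bochner_Integration.integral_sum)
  also have "\<dots> \<le> r * (\<Sum>u\<in>?N. \<Sum>v\<in>?N. 2 * (64 * exp (9 / 4) * k) ^ k)"
    by (intro mult_left_mono sum_mono one) auto
  also have "\<dots> = 2 * r * (64 * exp (9 / 4) * k) ^ k * (real (card ?N) * real (card ?N))"
    by simp
  also have "\<dots> \<le> 2 * r * (64 * exp (9 / 4) * k) ^ k * (48 ^ r * 48 ^ r)"
    by (intro mult_left_mono mult_mono card_int_net) auto
  also have "(48 :: real) ^ r * 48 ^ r = (48 ^ 8) ^ k"
    by (simp only: r_def power_add[symmetric] power_mult[symmetric]) (simp add: algebra_simps)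
  also have "2 * r * (64 * exp (9 / 4) * k) ^ k * (48 ^ 8) ^ k = 8 * k * (48 ^ 8 * 64 * exp (9 / 4) * k) ^ k"
    by (simp only: r_def power_mult_distrib) simp
  finally show ?thesis by (simp only: r_def)
qed

section \<open>The spectral norm of the noise\<close>

text \<open>
  The law of a measurement multiplied by the two planted signs: 1 for a correct edge, -1 for a
  flipped one, 0 for a non-edge.
\<close>

definition signed_edge :: "real \<Rightarrow> real \<Rightarrow> real pmf" where
  "signed_edge p \<epsilon> = bernoulli_pmf p \<bind>
     (\<lambda>b. if b then map_pmf (\<lambda>flipped. if flipped then -1 else 1) (bernoulli_pmf \<epsilon>) else return_pmf 0)"

lemma finite_signed_edge [simp]: "finite (set_pmf (signed_edge p \<epsilon>))"
  by (simp add: signed_edge_def)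

lemma expectation_signed_edge:
  fixes f :: "real \<Rightarrow> real"
  assumes "0 \<le> p" "p \<le> 1" "0 \<le> \<epsilon>" "\<epsilon> \<le> 1"
  shows "measure_pmf.expectation (signed_edge p \<epsilon>) f = p * ((1 - \<epsilon>) * f 1 + \<epsilon> * f (- 1)) + (1 - p) * f 0"
proof -
  have "measure_pmf.expectation (signed_edge p \<epsilon>) f
      = (\<Sum>b\<in>UNIV. pmf (bernoulli_pmf p) b *\<^sub>R measure_pmf.expectation
          (if b then map_pmf (\<lambda>flipped. if flipped then -1 else 1) (bernoulli_pmf \<epsilon>) else return_pmf 0) f)"
    unfolding signed_edge_def by (rule pmf_expectation_bind) auto
  then show ?thesis using assms by (simp add: UNIV_bool algebra_simps)
qed

definition edge_mean :: "real \<Rightarrow> real \<Rightarrow> real" where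
  "edge_mean p \<epsilon> = p * (1 - 2 * \<epsilon>)"

definition noise :: "real \<Rightarrow> real \<Rightarrow> (nat \<times> nat \<Rightarrow> real) \<Rightarrow> nat \<Rightarrow> nat \<Rightarrow> real" where
  "noise p \<epsilon> x = symm (\<lambda>e. x e - edge_mean p \<epsilon>)"

text \<open>
  The constant of the dense trace bound, times \<open>exp 2\<close>; this last factor produces the
  exponentially small probability in the moment method.
\<close>

definition norm_const :: real where
  "norm_const = 48 ^ 8 * 64 * exp (9 / 4) * exp 2"

context
  fixes n :: nat and p \<epsilon> :: real
  assumes p: "0 \<le> p" "p \<le> 1" and eps: "0 \<le> \<epsilon>" "\<epsilon> < 1 / 2"
begin

lemma edge_mean_bounds: "0 \<le> edge_mean p \<epsilon>" "edge_mean p \<epsilon> \<le> 1"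
proof -
  show "0 \<le> edge_mean p \<epsilon>" unfolding edge_mean_def using p eps by (intro mult_nonneg_nonneg) auto
  have "p * (1 - 2 * \<epsilon>) \<le> 1 * 1" using p eps by (intro mult_mono) auto
  then show "edge_mean p \<epsilon> \<le> 1" by (simp add: edge_mean_def)
qed

text \<open>
  The centred value has modulus at most 2 and variance at most \<open>p\<close>, so its \<open>k\<close>-th moment is at
  most \<open>2 ^ (k - 2) * p\<close>. First moments vanish on both sides.
\<close>

lemma centred_moment_le:
  assumes "0 < k"
  shows "\<bar>measure_pmf.expectation (signed_edge p \<epsilon>) (\<lambda>v. (v - edge_mean p \<epsilon>) ^ k)\<bar>
    \<le> p * measure_pmf.expectation skew_pmf (\<lambda>v. v ^ k)"
proof (cases "k = 1")
  case True
  then show ?thesis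
    using p eps by (simp add: expectation_signed_edge expectation_skew) (simp add: edge_mean_def algebra_simps)
next
  case False
  then have k: "2 \<le> k" using assms by simp
  have le: "\<bar>(v - edge_mean p \<epsilon>) ^ k\<bar> \<le> 2 ^ (k - 2) * (v - edge_mean p \<epsilon>)\<^sup>2" if "\<bar>v - edge_mean p \<epsilon>\<bar> \<le> 2" for v
  proof -
    have "\<bar>(v - edge_mean p \<epsilon>) ^ k\<bar> = \<bar>v - edge_mean p \<epsilon>\<bar> ^ (k - 2 + 2)"
      using k by (simp only: le_add_diff_inverse2 power_abs)
    also have "\<dots> = \<bar>v - edge_mean p \<epsilon>\<bar> ^ (k - 2) * (v - edge_mean p \<epsilon>)\<^sup>2" by (simp only: power_add power2_abs)
    also have "\<dots> \<le> 2 ^ (k - 2) * (v - edge_mean p \<epsilon>)\<^sup>2"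
      using that by (intro mult_right_mono power_mono) auto
    finally show ?thesis .
  qed
  have var: "measure_pmf.expectation (signed_edge p \<epsilon>) (\<lambda>v. (v - edge_mean p \<epsilon>)\<^sup>2) \<le> p"
  proof -
    have "measure_pmf.expectation (signed_edge p \<epsilon>) (\<lambda>v. (v - edge_mean p \<epsilon>)\<^sup>2) = p - (edge_mean p \<epsilon>)\<^sup>2"
      using p eps by (simp add: expectation_signed_edge)
        (simp add: edge_mean_def power2_eq_square algebra_simps)
    then show ?thesis by simp
  qed
  have "\<bar>measure_pmf.expectation (signed_edge p \<epsilon>) (\<lambda>v. (v - edge_mean p \<epsilon>) ^ k)\<bar>
      \<le> measure_pmf.expectation (signed_edge p \<epsilon>) (\<lambda>v. \<bar>(v - edge_mean p \<epsilon>) ^ k\<bar>)"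
    by (rule integral_abs_bound)
  also have "\<dots> \<le> measure_pmf.expectation (signed_edge p \<epsilon>) (\<lambda>v. 2 ^ (k - 2) * (v - edge_mean p \<epsilon>)\<^sup>2)"
    unfolding expectation_signed_edge[OF p eps(1) less_imp_le[OF order_less_trans[OF eps(2)]], simplified]
    using p eps edge_mean_bounds by (intro add_mono mult_left_mono le) auto
  also have "\<dots> \<le> 2 ^ (k - 2) * p" using var by (simp add: mult_left_mono)
  also have "\<dots> \<le> measure_pmf.expectation skew_pmf (\<lambda>v. v ^ k) * p"
    using k p by (intro mult_right_mono skew_moment_ge)
  finally show ?thesis by (simp add: mult.commute)
qed

text \<open>
  Each distinct edge of a closed walk contributes a factor \<open>p\<close>, and a walk on \<open>v\<close> vertices has
  at least \<open>v - 1\<close> edges, so the walk expansion of the trace is of the form that the comparison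
  with the dense matrix requires.
\<close>

lemma expectation_noise_trace_pow:
  assumes k: "0 < k" and np: "n * p \<le> 2 * k"
  shows "measure_pmf.expectation (iid_pairs n (signed_edge p \<epsilon>)) (\<lambda>x. trace_pow n (noise p \<epsilon> x) (2 * k))
    \<le> 4 * n * (48 ^ 8 * 64 * exp (9 / 4) * k) ^ k"
proof -
  let ?m = "2 * k"
  let ?\<mu> = "\<lambda>k. measure_pmf.expectation (signed_edge p \<epsilon>) (\<lambda>v. (v - edge_mean p \<epsilon>) ^ k)"
  let ?\<xi> = "\<lambda>k. measure_pmf.expectation skew_pmf (\<lambda>v. v ^ k)"
  let ?H = "\<lambda>w. pattern_moment ?\<xi> (close w)"
  have H0: "0 \<le> pattern_moment ?\<xi> w" for w
    unfolding pattern_moment_def by (auto intro!: prod_nonneg skew_moment_nonneg)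
  have "measure_pmf.expectation (iid_pairs n (signed_edge p \<epsilon>)) (\<lambda>x. trace_pow n (noise p \<epsilon> x) ?m)
      = (\<Sum>w\<in>walks n ?m. pattern_moment ?\<mu> (close w))"
    unfolding noise_def using k by (intro expectation_trace_pow) auto
  also have "\<dots> \<le> (\<Sum>w\<in>walks n ?m. p ^ (card (set w) - 1) * ?H w)"
  proof (rule sum_mono)
    fix w assume w: "w \<in> walks n ?m"
    let ?w = "close w" and ?E = "set (edges (close w))"
    have set: "set ?w = set w" using w k by (cases w) (auto simp: walks_def close_def)
    have "pattern_moment ?\<mu> ?w \<le> p ^ card ?E * ?H w"
    proof (cases "loopless ?w")
      case True
      have "pattern_moment ?\<mu> ?w \<le> \<bar>\<Prod>e\<in>?E. ?\<mu> (count_list (edges ?w) e)\<bar>"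
        using True by (simp add: pattern_moment_def)
      also have "\<dots> = (\<Prod>e\<in>?E. \<bar>?\<mu> (count_list (edges ?w) e)\<bar>)" by (rule abs_prod)
      also have "\<dots> \<le> (\<Prod>e\<in>?E. p * ?\<xi> (count_list (edges ?w) e))"
        by (intro prod_mono conjI centred_moment_le abs_ge_zero) (metis count_list_0_iff gr0I)
      also have "\<dots> = p ^ card ?E * ?H w" using True by (simp add: pattern_moment_def prod.distrib)
      finally show ?thesis .
    qed (simp add: pattern_moment_def)
    also have "\<dots> \<le> p ^ (card (set w) - 1) * ?H w"
      using p card_vertices_le_edges[of ?w] unfolding set
      by (intro mult_right_mono power_decreasing H0) auto
    finally show "pattern_moment ?\<mu> ?w \<le> p ^ (card (set w) - 1) * ?H w" .
  qed
  also have "\<dots> \<le> n / ?m * (\<Sum>u\<in>walks (2 * ?m) ?m. if u = [] then 0 else ?H u)"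
  proof -
    let ?H' = "\<lambda>w. if w = [] then 0 else ?H w"
    have "(\<Sum>w\<in>walks n ?m. p ^ (card (set w) - 1) * ?H w) = (\<Sum>w\<in>walks n ?m. p ^ (card (set w) - 1) * ?H' w)"
      using k by (intro sum.cong) (auto simp: walks_def)
    also have "\<dots> \<le> n / ?m * (\<Sum>u\<in>walks (2 * ?m) ?m. ?H' u)"
    proof (rule walk_sum_comparison)
      show "?H' u = ?H' w" if "same_pattern u w" for u w
      proof (cases "w = []")
        case True
        then show ?thesis using that by (auto simp: same_pattern_def)
      next
        case False
        then have "u \<noteq> []" using that by (auto simp: same_pattern_def)
        then show ?thesis
          using False pattern_moment_same_pattern[OF same_pattern_close[OF that False]] by simp
      qed
    qed (use k p np H0 in auto)
    finally show ?thesis .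
  qed
  also have "(\<Sum>u\<in>walks (2 * ?m) ?m. if u = [] then 0 else ?H u) = (\<Sum>u\<in>walks (4 * k) ?m. ?H u)"
    using k by (intro sum.cong) (auto simp: walks_def)
  also have "\<dots> = measure_pmf.expectation (iid_pairs (4 * k) skew_pmf) (\<lambda>x. trace_pow (4 * k) (symm x) ?m)"
    using k expectation_trace_pow[OF finite_skew, of ?m "4 * k" "\<lambda>v. v"] by simp
  also have "n / ?m * \<dots> \<le> n / ?m * (8 * k * (48 ^ 8 * 64 * exp (9 / 4) * k) ^ k)"
    using expectation_trace_pow_skew[OF k] by (intro mult_left_mono) simp_all
  also have "\<dots> = 4 * n * (48 ^ 8 * 64 * exp (9 / 4) * k) ^ k" using k by simp
  finally show ?thesis .
qed

text \<open>
  Markov's inequality for the trace of the power \<open>2 * 2 ^ s\<close>. Taking \<open>2 ^ s\<close> proportional to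
  \<open>n * p\<close> bounds the operator norm of the noise by a multiple of \<open>sqrt (n * p)\<close>.
\<close>

lemma noise_norm_tail:
  assumes np: "n * p \<le> 2 * 2 ^ s"
  defines "T \<equiv> sqrt (norm_const * 2 ^ s)"
  shows "measure_pmf.prob (iid_pairs n (signed_edge p \<epsilon>))
      {x. \<exists>v. T * dot n v v < \<bar>dot n v (app n (noise p \<epsilon> x) v)\<bar>} \<le> 4 * n * exp (- (2 * 2 ^ s))"
proof -
  let ?M = "iid_pairs n (signed_edge p \<epsilon>)" and ?k = "2 ^ s :: nat"
  let ?C = "48 ^ 8 * 64 * exp (9 / 4) * real ?k"
  have T: "0 < T" "T\<^sup>2 = exp 2 * ?C" by (simp_all add: T_def norm_const_def)
  have sym: "noise p \<epsilon> x i j = noise p \<epsilon> x j i" for x i j unfolding noise_def by (rule symm_commute)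
  have tr0: "0 \<le> trace_pow n (noise p \<epsilon> x) (2 * ?k)" for x
    using trace_pow_double[of n "noise p \<epsilon> x" ?k, OF sym] by (simp add: sum_nonneg)
  have "{x. \<exists>v. T * dot n v v < \<bar>dot n v (app n (noise p \<epsilon> x) v)\<bar>}
      \<subseteq> {x \<in> space ?M. T ^ (2 * ?k) \<le> trace_pow n (noise p \<epsilon> x) (2 * ?k)}"
  proof clarify
    fix x v assume v: "T * dot n v v < \<bar>dot n v (app n (noise p \<epsilon> x) v)\<bar>"
    have "dot n v v \<noteq> 0"
    proof
      assume "dot n v v = 0"
      then have "dot n v (app n (noise p \<epsilon> x) v) = 0" by (simp add: dot_self_eq_0_iff) (simp add: dot_def)
      with v \<open>dot n v v = 0\<close> show False by simp
    qed
    then have D: "0 < dot n v v" using dot_self_nonneg[of n v] by linarith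
    have "(T * dot n v v) ^ (2 * ?k) \<le> \<bar>dot n v (app n (noise p \<epsilon> x) v)\<bar> ^ (2 * ?k)"
      using v T D by (intro power_mono) auto
    also have "\<dots> \<le> trace_pow n (noise p \<epsilon> x) (2 * ?k) * dot n v v ^ (2 * ?k)"
      using quad_le_trace_pow[of n "noise p \<epsilon> x" v s, OF sym] by simp
    finally show "x \<in> space ?M \<and> T ^ (2 * ?k) \<le> trace_pow n (noise p \<epsilon> x) (2 * ?k)"
      using D by (simp add: power_mult_distrib)
  qed
  then have "measure_pmf.prob ?M {x. \<exists>v. T * dot n v v < \<bar>dot n v (app n (noise p \<epsilon> x) v)\<bar>}
      \<le> measure_pmf.prob ?M {x \<in> space ?M. T ^ (2 * ?k) \<le> trace_pow n (noise p \<epsilon> x) (2 * ?k)}"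
    by (intro measure_pmf.finite_measure_mono) auto
  also have "\<dots> \<le> measure_pmf.expectation ?M (\<lambda>x. trace_pow n (noise p \<epsilon> x) (2 * ?k)) / T ^ (2 * ?k)"
    using T tr0 by (intro integral_Markov_inequality_measure[where A = UNIV]
        integrable_measure_pmf_finite finite_set_iid_pairs) auto
  also have "\<dots> \<le> 4 * n * ?C ^ ?k / T ^ (2 * ?k)"
    using T np by (intro divide_right_mono expectation_noise_trace_pow) auto
  also have "\<dots> = 4 * n * (?C ^ ?k / (exp 2 * ?C) ^ ?k)" by (simp only: power_mult T) simp
  also have "?C ^ ?k / (exp 2 * ?C) ^ ?k = 1 / exp 2 ^ ?k"
    by (simp only: power_mult_distrib[of "exp 2"]) simp
  also have "\<dots> = exp (- (2 * 2 ^ s))" by (simp add: exp_minus field_simps flip: exp_of_nat_mult)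
  finally show ?thesis .
qed

section \<open>Degrees of the signed graph\<close>

text \<open>
  With \<open>a = 1 - 2 * \<epsilon>\<close> the exponential moment of a correct or flipped edge at \<open>- a\<close> is
  \<open>cosh a - a * sinh a\<close>, which agrees with \<open>1 - a\<^sup>2 / 2\<close> to second order and stays below it.
  The rate \<open>a\<close> is asymptotically the best one as \<open>a\<close> tends to 0.
\<close>

lemma mgf_signed_edge_le:
  "measure_pmf.expectation (signed_edge p \<epsilon>) (\<lambda>v. exp (- (1 - 2 * \<epsilon>) * v)) \<le> exp (- (p * (1 - 2 * \<epsilon>)\<^sup>2 / 2))"
proof -
  define a where "a = 1 - 2 * \<epsilon>"
  have a: "0 \<le> a" "a \<le> 1" using eps by (simp_all add: a_def)
  define h where "h = (\<lambda>t::real. t * sinh t - cosh t - t\<^sup>2 / 2)"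
  have "h 0 \<le> h a"
  proof (rule DERIV_nonneg_imp_nondecreasing[OF a(1)])
    fix t :: real assume "0 \<le> t"
    have "(h has_real_derivative t * (cosh t - 1)) (at t)"
      unfolding h_def by (auto intro!: derivative_eq_intros simp: algebra_simps)
    moreover have "0 \<le> t * (cosh t - 1)" using \<open>0 \<le> t\<close> cosh_real_ge_1 by simp
    ultimately show "\<exists>y. (h has_real_derivative y) (at t) \<and> 0 \<le> y" by blast
  qed
  then have h: "cosh a - a * sinh a \<le> 1 - a\<^sup>2 / 2" by (simp add: h_def)
  have "measure_pmf.expectation (signed_edge p \<epsilon>) (\<lambda>v. exp (- a * v))
      = p * ((1 - \<epsilon>) * exp (- a) + \<epsilon> * exp a) + (1 - p)"
    using p eps by (simp add: expectation_signed_edge)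
  also have "(1 - \<epsilon>) * exp (- a) + \<epsilon> * exp a = cosh a - a * sinh a"
    by (simp add: cosh_def sinh_def a_def field_simps)
  also have "p * (cosh a - a * sinh a) + (1 - p) \<le> p * (1 - a\<^sup>2 / 2) + (1 - p)"
    using p h by (intro add_right_mono mult_left_mono)
  also have "\<dots> = 1 + - (p * a\<^sup>2 / 2)" by (simp add: algebra_simps)
  also have "\<dots> \<le> exp (- (p * a\<^sup>2 / 2))" by (rule exp_ge_add_one_self)
  finally show ?thesis by (simp add: a_def)
qed

text \<open>
  Chernoff's bound at rate \<open>1 - 2 * \<epsilon>\<close>.
\<close>

lemma degree_lower_tail:
  assumes i: "i < n"
  shows "measure_pmf.prob (iid_pairs n (signed_edge p \<epsilon>)) {x. (\<Sum>j<n. symm x i j) \<le> t}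
    \<le> exp ((1 - 2 * \<epsilon>) * t - (real n - 1) * p * (1 - 2 * \<epsilon>)\<^sup>2 / 2)"
proof -
  let ?M = "iid_pairs n (signed_edge p \<epsilon>)"
  define a where "a = 1 - 2 * \<epsilon>"
  have a: "0 < a" using eps by (simp add: a_def)
  define c where "c = (\<lambda>e. unit_at i (fst e) + unit_at i (snd e))"
  have deg: "(\<Sum>j<n. symm x i j) = (\<Sum>e\<in>node_pairs n. c e * x e)" for x
    using dot_app_symm[of n "unit_at i" x "\<lambda>_. 1"] i by (simp add: c_def app_def)
  have c01: "c e = 0 \<or> c e = 1" if "e \<in> node_pairs n" for e
    using that by (auto simp: c_def unit_at_def node_pairs_def)
  have csum: "(\<Sum>e\<in>node_pairs n. c e) = real n - 1"
  proof -
    have "(\<Sum>e\<in>node_pairs n. c e) = (\<Sum>j<n. symm (\<lambda>_. 1) i j)" by (simp add: deg)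
    also have "\<dots> = (\<Sum>j<n. 1 - (if j = i then 1 else 0))"
      by (intro sum.cong) (auto simp: symm_def)
    also have "\<dots> = real n - 1" using i by (simp add: sum_subtractf)
    finally show ?thesis .
  qed
  let ?g = "\<lambda>x. exp (a * t - a * (\<Sum>j<n. symm x i j))"
  have "measure_pmf.prob ?M {x. (\<Sum>j<n. symm x i j) \<le> t}
      \<le> measure_pmf.prob ?M {x \<in> space ?M. 1 \<le> ?g x}"
    using a by (intro measure_pmf.finite_measure_mono) auto
  also have "\<dots> \<le> measure_pmf.expectation ?M ?g / 1"
    by (intro integral_Markov_inequality_measure[where A = UNIV]
        integrable_measure_pmf_finite finite_set_iid_pairs) auto
  also have "measure_pmf.expectation ?M ?g
      = exp (a * t) * measure_pmf.expectation ?M (\<lambda>x. \<Prod>e\<in>node_pairs n. exp (- a * c e * x e))"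
  proof -
    have "a * t - a * (\<Sum>j<n. symm x i j) = a * t + (\<Sum>e\<in>node_pairs n. - a * c e * x e)" for x
      by (simp add: deg sum_distrib_left sum_negf mult.assoc)
    then have "?g x = exp (a * t) * (\<Prod>e\<in>node_pairs n. exp (- a * c e * x e))" for x
      by (simp only: exp_add exp_sum finite_node_pairs)
    then show ?thesis by simp
  qed
  also have "measure_pmf.expectation ?M (\<lambda>x. \<Prod>e\<in>node_pairs n. exp (- a * c e * x e))
      = (\<Prod>e\<in>node_pairs n. measure_pmf.expectation (signed_edge p \<epsilon>) (\<lambda>v. exp (- a * c e * v)))"
    by (rule expectation_prod_iid_pairs) simp
  also have "\<dots> \<le> (\<Prod>e\<in>node_pairs n. exp (- (p * a\<^sup>2 / 2) * c e))"
  proof (intro prod_mono conjI integral_nonneg)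
    fix e assume "e \<in> node_pairs n"
    then show "measure_pmf.expectation (signed_edge p \<epsilon>) (\<lambda>v. exp (- a * c e * v)) \<le> exp (- (p * a\<^sup>2 / 2) * c e)"
      using c01[of e] mgf_signed_edge_le by (auto simp: a_def)
  qed simp
  also have "\<dots> = exp (- (p * a\<^sup>2 / 2) * (real n - 1))"
    by (simp only: csum[symmetric] sum_distrib_left exp_sum finite_node_pairs)
  also have "exp (a * t) * exp (- (p * a\<^sup>2 / 2) * (real n - 1)) = exp (a * t - (real n - 1) * p * a\<^sup>2 / 2)"
    by (simp add: algebra_simps flip: exp_add)
  finally show ?thesis by (simp add: a_def)
qed

end

section \<open>From the measurements to exact recovery\<close>

definition measured :: "nat \<Rightarrow> real vec \<Rightarrow> (nat \<times> nat \<Rightarrow> real) \<Rightarrow> real mat" where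
  "measured n z x = mat n n (\<lambda>(i, j). z $ i * z $ j * symm x i j)"

text \<open>
  Conditionally on the graph the measurements are independent, and so are the edges; hence the
  pairs (edge, measurement) are independent, and multiplying by the planted signs makes them
  identically distributed.
\<close>

lemma z2_sync_eq:
  assumes z: "z \<in> sign_vecs n"
  shows "z2_sync n p \<epsilon> z = map_pmf (measured n z) (iid_pairs n (signed_edge p \<epsilon>))"
proof -
  let ?N = "node_pairs n" and ?zz = "\<lambda>e :: nat \<times> nat. z $ fst e * z $ snd e"
  let ?mat = "\<lambda>y. mat n n (\<lambda>(i, j). if i < j then y (i, j) else if j < i then y (j, i) else 0 :: real)"
  have edge: "bernoulli_pmf p \<bind> (\<lambda>b. if b then noisy_measurement \<epsilon> z e else return_pmf 0)
      = signed_edge p \<epsilon> \<bind> (\<lambda>s. return_pmf (?zz e * s))" for e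
    unfolding signed_edge_def bind_assoc_pmf
    by (intro bind_pmf_cong refl)
       (auto simp: noisy_measurement_def split_def bind_return_pmf map_bind_pmf
          map_pmf_comp if_distrib simp flip: map_pmf_def cong: if_cong)
  have "z2_sync n p \<epsilon> z = (erdos_renyi n p \<bind> (\<lambda>G. Pi_pmf ?N 0
      (\<lambda>e. if G e then noisy_measurement \<epsilon> z e else return_pmf 0))) \<bind> (\<lambda>y. return_pmf (?mat y))"
    by (simp add: z2_sync_def bind_assoc_pmf)
  also have "erdos_renyi n p \<bind> (\<lambda>G. Pi_pmf ?N 0 (\<lambda>e. if G e then noisy_measurement \<epsilon> z e else return_pmf 0))
      = Pi_pmf ?N 0 (\<lambda>e. bernoulli_pmf p \<bind> (\<lambda>b. if b then noisy_measurement \<epsilon> z e else return_pmf 0))"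
    unfolding erdos_renyi_def
    by (rule Pi_pmf_bind[OF finite_node_pairs, symmetric])
  also have "\<dots> = iid_pairs n (signed_edge p \<epsilon>) \<bind> (\<lambda>x. Pi_pmf ?N 0 (\<lambda>e. return_pmf (?zz e * x e)))"
    unfolding edge by (rule Pi_pmf_bind) simp
  also have "\<dots> = map_pmf (\<lambda>x e. if e \<in> ?N then ?zz e * x e else 0) (iid_pairs n (signed_edge p \<epsilon>))"
    by (simp add: map_pmf_def)
  finally have "z2_sync n p \<epsilon> z
      = map_pmf (\<lambda>x. ?mat (\<lambda>e. if e \<in> ?N then ?zz e * x e else 0)) (iid_pairs n (signed_edge p \<epsilon>))"
    by (simp add: map_pmf_comp flip: map_pmf_def)
  also have "(\<lambda>x. ?mat (\<lambda>e. if e \<in> ?N then ?zz e * x e else 0)) = measured n z"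
    by (intro ext eq_matI) (auto simp: measured_def symm_def node_pairs_def)
  finally show ?thesis .
qed

lemma laplacian_form:
  fixes S :: "nat \<Rightarrow> nat \<Rightarrow> real"
  assumes "\<And>i j. S i j = S j i"
  shows "(\<Sum>i<n. (\<Sum>j<n. S i j) * (w i)\<^sup>2) - dot n w (app n S w)
    = (\<Sum>i<n. \<Sum>j<n. S i j * (w i - w j)\<^sup>2) / 2"
proof -
  have row: "(\<Sum>i<n. \<Sum>j<n. S i j * (w i)\<^sup>2) = (\<Sum>i<n. (\<Sum>j<n. S i j) * (w i)\<^sup>2)"
    by (simp add: sum_distrib_right)
  have "(\<Sum>i<n. \<Sum>j<n. S i j * (w j)\<^sup>2) = (\<Sum>j<n. \<Sum>i<n. S i j * (w j)\<^sup>2)" by (rule sum.swap)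
  also have "\<dots> = (\<Sum>i<n. \<Sum>j<n. S i j * (w i)\<^sup>2)" using assms by simp
  finally have col: "(\<Sum>i<n. \<Sum>j<n. S i j * (w j)\<^sup>2) = (\<Sum>i<n. (\<Sum>j<n. S i j) * (w i)\<^sup>2)"
    using row by simp
  have mixed: "dot n w (app n S w) = (\<Sum>i<n. \<Sum>j<n. S i j * (w i * w j))"
    by (simp add: dot_def app_def sum_distrib_left mult_ac)
  have "S i j * (w i - w j)\<^sup>2 = S i j * (w i)\<^sup>2 + S i j * (w j)\<^sup>2 - 2 * (S i j * (w i * w j))" for i j
    by (simp add: power2_eq_square algebra_simps)
  then have "(\<Sum>i<n. \<Sum>j<n. S i j * (w i - w j)\<^sup>2)
      = (\<Sum>i<n. \<Sum>j<n. S i j * (w i)\<^sup>2) + (\<Sum>i<n. \<Sum>j<n. S i j * (w j)\<^sup>2)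
        - 2 * (\<Sum>i<n. \<Sum>j<n. S i j * (w i * w j))"
    by (simp add: sum.distrib sum_subtractf sum_distrib_left)
  then show ?thesis by (simp add: row col mixed)
qed

lemma noise_eq: "noise p \<epsilon> x i j = symm x i j - (if i = j then 0 else edge_mean p \<epsilon>)"
  by (simp add: noise_def symm_def)

text \<open>
  After multiplication by the signs \<open>z\<close>, the slack form is the Laplacian form of the signed
  graph. It depends only on the part \<open>h\<close> of its argument orthogonal to the constants. On that
  part the expectation of the off-diagonal matrix acts as \<open>- edge_mean p \<epsilon>\<close>, which only helps,
  so the smallest signed degree minus the noise norm is a lower bound for the spectrum.
\<close>

lemma exact_recovery_measured:
  assumes p: "0 \<le> p" "p \<le> 1" and eps: "0 \<le> \<epsilon>" "\<epsilon> < 1 / 2"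
    and z: "z \<in> sign_vecs n" and n: "0 < n"
    and deg: "\<And>i. i < n \<Longrightarrow> T < (\<Sum>j<n. symm x i j)"
    and norm: "\<And>v. \<bar>dot n v (app n (noise p \<epsilon> x) v)\<bar> \<le> T * dot n v v"
  shows "exact_recovery n z (measured n z x)"
proof -
  let ?S = "symm x" and ?c = "edge_mean p \<epsilon>"
  let ?d = "\<lambda>i. \<Sum>j<n. ?S i j"
  have zz: "z $ i * z $ i = 1" if "i < n" for i using z that by (auto simp: sign_vecs_def)
  define D where "D = Min (?d ` {..<n})"
  have D: "T < D" unfolding D_def using deg n by (subst Min_gr_iff) auto
  have dD: "D \<le> ?d i" if "i < n" for i unfolding D_def using that by (intro Min_le) auto
  show ?thesis
  proof (rule recovery_certificate[OF n z, where c = "D - T"])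
    show "measured n z x \<in> carrier_mat n n" by (simp add: measured_def)
    show "0 < D - T" using D by simp
    fix y :: "nat \<Rightarrow> real"
    let ?Y = "\<lambda>i j. measured n z x $$ (i, j)"
    define w where "w = (\<lambda>i. z $ i * y i)"
    define b where "b = (\<Sum>i<n. w i) / n"
    define h where "h = (\<lambda>i. w i - b)"
    have Yij: "?Y i j = z $ i * z $ j * ?S i j" if "i < n" "j < n" for i j
      using that by (simp add: measured_def)
    have w2: "(w i)\<^sup>2 = (y i)\<^sup>2" if "i < n" for i
      using zz[OF that] by (simp add: w_def power_mult_distrib power2_eq_square)
    have e1: "(\<Sum>i<n. (\<Sum>j<n. ?Y i j * z $ i * z $ j) * (y i)\<^sup>2) = (\<Sum>i<n. ?d i * (w i)\<^sup>2)"
    proof (rule sum.cong[OF refl])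
      fix i assume i: "i \<in> {..<n}"
      have "?Y i j * z $ i * z $ j = ?S i j" if "j < n" for j
      proof -
        have "?Y i j * z $ i * z $ j = (z $ i * z $ i) * (z $ j * z $ j) * ?S i j"
          using i that by (simp add: Yij mult_ac)
        also have "\<dots> = ?S i j" using i that by (simp add: zz)
        finally show ?thesis .
      qed
      then show "(\<Sum>j<n. ?Y i j * z $ i * z $ j) * (y i)\<^sup>2 = ?d i * (w i)\<^sup>2"
        using i by (simp add: w2)
    qed
    have e2: "dot n y (app n ?Y y) = dot n w (app n ?S w)"
      unfolding dot_def app_def sum_distrib_left
      by (intro sum.cong refl) (simp add: Yij w_def mult_ac)
    have "dot n y y = dot n w w"
      unfolding dot_def by (intro sum.cong refl) (simp add: w2 flip: power2_eq_square)
    moreover have "dot n (($) z) y = n * b"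
      using n by (simp add: dot_def w_def b_def)
    moreover have hh: "dot n h h = dot n w w - n * b\<^sup>2"
    proof -
      have "h i * h i = w i * w i - 2 * b * w i + b\<^sup>2" for i
        by (simp add: h_def power2_eq_square algebra_simps)
      then have "dot n h h = dot n w w - 2 * b * (\<Sum>i<n. w i) + n * b\<^sup>2"
        by (simp add: dot_def sum.distrib sum_subtractf sum_distrib_left)
      also have "(\<Sum>i<n. w i) = n * b" using n by (simp add: b_def)
      finally show ?thesis by (simp add: power2_eq_square algebra_simps)
    qed
    ultimately have e3: "dot n y y - (dot n (($) z) y)\<^sup>2 / n = dot n h h"
      using n by (simp add: power2_eq_square)
    \<comment> \<open>the Laplacian form does not see the component of \<open>w\<close> along the constants\<close>
    have "(\<Sum>i<n. ?d i * (w i)\<^sup>2) - dot n w (app n ?S w) = (\<Sum>i<n. ?d i * (h i)\<^sup>2) - dot n h (app n ?S h)"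
      unfolding laplacian_form[of ?S, OF symm_commute] by (simp add: h_def)
    moreover have "D * dot n h h \<le> (\<Sum>i<n. ?d i * (h i)\<^sup>2)"
      unfolding dot_def sum_distrib_left
      by (intro sum_mono) (simp add: mult_right_mono dD flip: power2_eq_square)
    moreover have "dot n h (app n ?S h) \<le> T * dot n h h"
    proof -
      have h0: "(\<Sum>i<n. h i) = 0" using n by (simp add: h_def b_def sum_subtractf)
      have "app n ?S h i = app n (noise p \<epsilon> x) h i - ?c * h i" if "i < n" for i
      proof -
        have "?S i j * h j = noise p \<epsilon> x i j * h j + (?c * h j - (if j = i then ?c * h i else 0))" for j
          by (simp add: noise_eq algebra_simps)
        then have "app n ?S h i = app n (noise p \<epsilon> x) h i + (?c * (\<Sum>j<n. h j) - ?c * h i)"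
          using that by (simp add: app_def sum.distrib sum_subtractf sum_distrib_left)
        then show ?thesis by (simp add: h0)
      qed
      then have "dot n h (app n ?S h) = dot n h (app n (noise p \<epsilon> x) h) - ?c * dot n h h"
        by (simp add: dot_def right_diff_distrib sum_subtractf sum_distrib_left mult_ac)
      moreover have "0 \<le> ?c * dot n h h" using edge_mean_bounds[OF p eps] by simp
      ultimately show ?thesis using norm[of h] by linarith
    qed
    ultimately show "(D - T) * (dot n y y - (dot n (($) z) y)\<^sup>2 / n)
        \<le> (\<Sum>i<n. (\<Sum>j<n. ?Y i j * z $ i * z $ j) * (y i)\<^sup>2) - dot n y (app n ?Y y)"
      unfolding e1 e2 e3 by (simp add: algebra_simps)
  qed
qed

lemma recovery_probability:
  assumes p: "0 \<le> p" "p \<le> 1" and eps: "0 \<le> \<epsilon>" "\<epsilon> < 1 / 2"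
    and z: "z \<in> sign_vecs n" and n: "0 < n" and np: "n * p \<le> 2 * 2 ^ s"
  shows "measure_pmf.prob (z2_sync n p \<epsilon> z) {Y. exact_recovery n z Y}
    \<ge> 1 - 4 * n * exp (- (2 * 2 ^ s))
        - n * exp ((1 - 2 * \<epsilon>) * sqrt (norm_const * 2 ^ s) - (real n - 1) * p * (1 - 2 * \<epsilon>)\<^sup>2 / 2)"
proof -
  let ?M = "iid_pairs n (signed_edge p \<epsilon>)"
  define T where "T = sqrt (norm_const * 2 ^ s)"
  let ?bad = "{x. \<exists>v. T * dot n v v < \<bar>dot n v (app n (noise p \<epsilon> x) v)\<bar>}"
  let ?low = "\<lambda>i. {x. (\<Sum>j<n. symm x i j) \<le> T}"
  let ?e = "exp ((1 - 2 * \<epsilon>) * T - (real n - 1) * p * (1 - 2 * \<epsilon>)\<^sup>2 / 2)"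
  let ?good = "{x. exact_recovery n z (measured n z x)}"
  have "UNIV \<subseteq> ?good \<union> (?bad \<union> (\<Union>i<n. ?low i))"
  proof
    fix x
    show "x \<in> ?good \<union> (?bad \<union> (\<Union>i<n. ?low i))"
    proof (cases "x \<in> ?bad \<union> (\<Union>i<n. ?low i)")
      case False
      then have "T < (\<Sum>j<n. symm x i j)" if "i < n" for i using that by (simp add: not_le)
      moreover have "\<bar>dot n v (app n (noise p \<epsilon> x) v)\<bar> \<le> T * dot n v v" for v
        using False by (simp add: not_less)
      ultimately have "exact_recovery n z (measured n z x)"
        by (rule exact_recovery_measured[OF p eps z n])
      then show ?thesis by simp
    qed simp
  qed
  then have "1 \<le> measure_pmf.prob ?M (?good \<union> (?bad \<union> (\<Union>i<n. ?low i)))"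
    by (simp add: top.extremum_unique)
  also have "\<dots> \<le> measure_pmf.prob ?M ?good + (measure_pmf.prob ?M ?bad + (\<Sum>i<n. measure_pmf.prob ?M (?low i)))"
    by (intro order_trans[OF measure_Un_le] add_left_mono measure_UNION_le) auto
  also have "\<dots> \<le> measure_pmf.prob ?M ?good + (4 * n * exp (- (2 * 2 ^ s)) + (\<Sum>i<n. ?e))"
    unfolding T_def using noise_norm_tail[OF p eps np] degree_lower_tail[OF p eps]
    by (intro add_left_mono add_mono sum_mono) auto
  finally show ?thesis
    by (simp add: z2_sync_eq[OF z] T_def vimage_def)
qed

lemma dyadic_between:
  assumes "1 \<le> (y :: real)"
  obtains s where "y \<le> 2 ^ s" "2 ^ s \<le> 2 * y"
proof -
  obtain t where t: "y \<le> 2 ^ t" using real_arch_pow[of 2 y] by (auto intro: less_imp_le)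
  define s where "s = (LEAST s. y \<le> 2 ^ s)"
  have s: "y \<le> 2 ^ s" unfolding s_def using t by (rule LeastI)
  have "2 ^ s \<le> 2 * y"
  proof (cases s)
    case (Suc r)
    then have "\<not> y \<le> 2 ^ r" using not_less_Least[of r "\<lambda>s. y \<le> 2 ^ s"] by (simp add: s_def)
    then show ?thesis using Suc by simp
  qed (use assms in simp)
  with s show thesis by (rule that)
qed

text \<open>
  A signed degree has mean about \<open>a * q\<close>, where \<open>a = 1 - 2 * \<epsilon>\<close> and \<open>q = (n - 1) * p\<close>, and
  falls below the noise level, which is of order \<open>sqrt q\<close>, with probability about
  \<open>exp (- a\<^sup>2 * q / 2)\<close>. The threshold makes the exponent at least \<open>(1 + \<delta>) * ln n\<close>, the noise
  level changes it by a quantity of the order of its square root, and this is absorbed by a part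
  of \<open>\<delta>\<close>; the rest survives the union bound over the \<open>n\<close> degrees.
\<close>

lemma recovery_probability_above_threshold:
  assumes p: "0 \<le> p" "p \<le> 1" and eps: "0 \<le> \<epsilon>" "\<epsilon> < 1 / 2"
    and z: "z \<in> sign_vecs n" and n: "3 \<le> n" and \<delta>: "0 < \<delta>"
    and thr: "(1 + \<delta>) * (2 / (1 - 2 * \<epsilon>)\<^sup>2) * ln n \<le> (real n - 1) * p"
    and large: "16 * norm_const * (1 + \<delta>) / \<delta>\<^sup>2 \<le> ln n"
  shows "measure_pmf.prob (z2_sync n p \<epsilon> z) {Y. exact_recovery n z Y}
    \<ge> 1 - 4 * n powr (- 1) - n powr (- (\<delta> / 2))"
proof -
  define a where "a = 1 - 2 * \<epsilon>"
  define q where "q = (real n - 1) * p"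
  define L where "L = ln n"
  have a: "0 < a" "a \<le> 1" using eps by (simp_all add: a_def)
  have C: "0 < norm_const" by (simp add: norm_const_def)
  have "exp 1 \<le> real n" using n exp_le by linarith
  then have L1: "1 \<le> L" unfolding L_def using n by (subst ln_ge_iff) auto
  have nL: "real n = exp L" using n by (simp add: L_def)
  have thr': "2 * (1 + \<delta>) * L \<le> a\<^sup>2 * q"
  proof -
    have "a\<^sup>2 * ((1 + \<delta>) * (2 / a\<^sup>2) * L) \<le> a\<^sup>2 * q"
      using thr by (intro mult_left_mono) (simp_all add: q_def L_def a_def)
    then show ?thesis using a by (simp add: mult_ac)
  qed
  have a2: "a\<^sup>2 \<le> 1" using a by (simp add: power_le_one)
  have q0: "0 \<le> q" unfolding q_def using n p by (intro mult_nonneg_nonneg) auto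
  have "2 * L \<le> 2 * (1 + \<delta>) * L" using \<delta> L1 by simp
  also have "\<dots> \<le> a\<^sup>2 * q" by (rule thr')
  also have "\<dots> \<le> 1 * q" using a2 q0 by (rule mult_right_mono)
  finally have q2: "2 * L \<le> q" by simp
  have npq: "q \<le> n * p" "n * p \<le> 2 * q"
  proof -
    show "q \<le> n * p" using p by (simp add: q_def algebra_simps)
    have "real n * p \<le> (2 * (real n - 1)) * p" using n p by (intro mult_right_mono) auto
    then show "n * p \<le> 2 * q" by (simp only: q_def mult.assoc)
  qed
  have "1 \<le> n * p / 2" using npq q2 L1 by simp
  from dyadic_between[OF this] obtain s where s: "n * p / 2 \<le> 2 ^ s" "2 ^ s \<le> 2 * (n * p / 2)"
    by blast
  have low: "n * exp (- (2 * 2 ^ s)) \<le> n powr (- 1)"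
  proof -
    have "exp (- (2 * 2 ^ s)) \<le> exp (- 2 * L)" using s npq q2 by simp
    then have "n * exp (- (2 * 2 ^ s)) \<le> exp L * exp (- 2 * L)"
      unfolding nL by (intro mult_left_mono) auto
    also have "\<dots> = exp (- 1 * L)" by (simp flip: exp_add)
    also have "\<dots> = n powr (- 1)" using n by (simp only: powr_def L_def) simp
    finally show ?thesis .
  qed
  \<comment> \<open>\<open>\<eta>\<close> is the share of the exponent spent on the noise level, by AM-GM:
     \<open>(1 - \<eta>) * (1 + \<delta>) = 1 + 3 * \<delta> / 4\<close>, of which \<open>\<delta> / 4\<close> covers the constant term\<close>
  define \<eta> where "\<eta> = \<delta> / (4 * (1 + \<delta>))"
  have \<eta>: "0 < \<eta>" "\<eta> < 1" using \<delta> by (simp_all add: \<eta>_def)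
  have "a * sqrt (norm_const * 2 ^ s) - q * a\<^sup>2 / 2 \<le> - ((1 + \<delta> / 2) * L)"
  proof -
    have arith: "x \<le> l - u / 2 \<Longrightarrow> v \<le> u \<Longrightarrow> v = 2 * y + 2 * l \<Longrightarrow> x \<le> - y" for x l u v y :: real
      by linarith
    have "a * sqrt (norm_const * 2 ^ s) \<le> a * sqrt (norm_const * (2 * q))"
      using s npq a C by (intro mult_left_mono real_sqrt_le_mono) auto
    also have "\<dots> = sqrt ((\<eta> * (a\<^sup>2 * q)) * (2 * norm_const / \<eta>))"
      using a \<eta> by (simp add: real_sqrt_mult mult_ac)
    also have "\<dots> \<le> (\<eta> * (a\<^sup>2 * q) + 2 * norm_const / \<eta>) / 2"
      using \<eta> q0 C by (intro arith_geo_mean_sqrt) auto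
    also have "\<dots> = \<eta> * (a\<^sup>2 * q) / 2 + norm_const / \<eta>" by simp
    also have "norm_const / \<eta> = (16 * norm_const * (1 + \<delta>) / \<delta>\<^sup>2) * (\<delta> / 4)"
      using \<delta> by (simp add: \<eta>_def power2_eq_square)
    also have "\<dots> \<le> L * (\<delta> / 4)" using large \<delta> by (intro mult_right_mono) (auto simp: L_def)
    finally have "a * sqrt (norm_const * 2 ^ s) \<le> \<eta> * (a\<^sup>2 * q) / 2 + L * (\<delta> / 4)" by simp
    moreover have "(1 - \<eta>) * (a\<^sup>2 * q) / 2 = q * a\<^sup>2 / 2 - \<eta> * (a\<^sup>2 * q) / 2"
      by (simp add: left_diff_distrib diff_divide_distrib mult.commute)
    ultimately have "a * sqrt (norm_const * 2 ^ s) - q * a\<^sup>2 / 2 \<le> L * (\<delta> / 4) - (1 - \<eta>) * (a\<^sup>2 * q) / 2"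
      by linarith
    moreover have "(1 - \<eta>) * (2 * (1 + \<delta>) * L) \<le> (1 - \<eta>) * (a\<^sup>2 * q)"
      using thr' \<eta> by (intro mult_left_mono) auto
    moreover have "(1 - \<eta>) * (2 * (1 + \<delta>) * L) = 2 * ((1 + \<delta> / 2) * L) + 2 * (L * (\<delta> / 4))"
    proof -
      have "(1 - \<eta>) * (2 * (1 + \<delta>) * L) = 2 * ((1 - \<eta>) * (1 + \<delta>)) * L" by (simp only: mult_ac)
      also have "(1 - \<eta>) * (1 + \<delta>) = 1 + 3 * \<delta> / 4" using \<delta> by (simp add: \<eta>_def field_simps)
      also have "2 * (1 + 3 * \<delta> / 4) * L = 2 * ((1 + \<delta> / 2) * L) + 2 * (L * (\<delta> / 4))"
        by (simp add: algebra_simps)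
      finally show ?thesis .
    qed
    ultimately show ?thesis by (rule arith)
  qed
  then have "n * exp (a * sqrt (norm_const * 2 ^ s) - q * a\<^sup>2 / 2) \<le> exp L * exp (- ((1 + \<delta> / 2) * L))"
    unfolding nL by (intro mult_left_mono) auto
  also have "\<dots> = exp (- (\<delta> / 2) * L)" by (simp add: algebra_simps flip: exp_add)
  also have "\<dots> = n powr (- (\<delta> / 2))" using n by (simp only: powr_def L_def) simp
  finally show ?thesis
    using recovery_probability[OF p eps z, of s] n s low by (simp add: a_def q_def)
qed

theorem corollary4p7:
  shows "\<exists>K::real. \<forall>(p::nat \<Rightarrow> real) (\<epsilon>::nat \<Rightarrow> real) (z::nat \<Rightarrow> real vec) (\<delta>::real).
    (\<forall>n. 0 \<le> p n \<and> p n \<le> 1 \<and> 0 \<le> \<epsilon> n \<and> \<epsilon> n < 1/2 \<and> z n \<in> sign_vecs n) \<longrightarrow>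
    (\<forall>\<^sub>F n in sequentially. p n * (1 - 2 * \<epsilon> n)\<^sup>2 \<le> 1/2) \<longrightarrow>
    \<delta> > 0 \<longrightarrow>
    (\<forall>\<^sub>F n in sequentially.
       (real n - 1) * p n \<ge> (1 + \<delta>) * (2 / (1 - 2 * \<epsilon> n)\<^sup>2)
         * (1 + K / sqrt (ln (real n)) + 5/3 * (1 - 2 * \<epsilon> n)) * ln (real n)) \<longrightarrow>
    with_high_probability (\<lambda>n. z2_sync n (p n) (\<epsilon> n) (z n))
      (\<lambda>n. {Y. exact_recovery n (z n) Y})"
proof (intro exI[of _ 0] allI impI)
  fix p \<epsilon> :: "nat \<Rightarrow> real" and z :: "nat \<Rightarrow> real vec" and \<delta> :: real
  assume par: "\<forall>n. 0 \<le> p n \<and> p n \<le> 1 \<and> 0 \<le> \<epsilon> n \<and> \<epsilon> n < 1/2 \<and> z n \<in> sign_vecs n"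
    and \<delta>: "\<delta> > 0"
    and thr: "\<forall>\<^sub>F n in sequentially. (real n - 1) * p n \<ge> (1 + \<delta>) * (2 / (1 - 2 * \<epsilon> n)\<^sup>2)
         * (1 + 0 / sqrt (ln (real n)) + 5/3 * (1 - 2 * \<epsilon> n)) * ln (real n)"
  define \<kappa> where "\<kappa> = min (1 / 2) (\<delta> / 4)"
  have \<kappa>: "0 < \<kappa>" "\<kappa> \<le> 1 / 2" "\<kappa> \<le> \<delta> / 4" using \<delta> by (simp_all add: \<kappa>_def)
  have "filterlim (\<lambda>n. ln (real n)) at_top sequentially" by real_asymp
  then have large: "\<forall>\<^sub>F n in sequentially. 16 * norm_const * (1 + \<delta>) / \<delta>\<^sup>2 \<le> ln (real n)"
    by (simp add: filterlim_at_top)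
  have small: "\<forall>\<^sub>F n in sequentially. 4 * real n powr (- 1 / 2) + real n powr (- (\<delta> / 4)) \<le> 1"
  proof -
    have "(\<lambda>n. 4 * real n powr (- 1 / 2) + real n powr (- (\<delta> / 4))) \<longlonglongrightarrow> 4 * 0 + 0"
      using \<delta> by (intro tendsto_intros tendsto_neg_powr filterlim_real_sequentially) auto
    then have "\<forall>\<^sub>F n in sequentially. 4 * real n powr (- 1 / 2) + real n powr (- (\<delta> / 4)) < 1"
      by (rule order_tendstoD) simp
    then show ?thesis by (rule eventually_mono) simp
  qed
  have "\<forall>\<^sub>F n in sequentially. 1 - real n powr (- \<kappa>)
      \<le> measure_pmf.prob (z2_sync n (p n) (\<epsilon> n) (z n)) {Y. exact_recovery n (z n) Y}"
    using thr large small eventually_ge_at_top[of 3]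
  proof eventually_elim
    case (elim n)
    have par_n: "0 \<le> p n" "p n \<le> 1" "0 \<le> \<epsilon> n" "\<epsilon> n < 1 / 2" "z n \<in> sign_vecs n"
      using par by auto
    have "(1 + \<delta>) * (2 / (1 - 2 * \<epsilon> n)\<^sup>2) * 1 * ln (real n)
        \<le> (1 + \<delta>) * (2 / (1 - 2 * \<epsilon> n)\<^sup>2) * (1 + 0 / sqrt (ln (real n)) + 5/3 * (1 - 2 * \<epsilon> n)) * ln (real n)"
      using par_n \<delta> elim(4) by (intro mult_right_mono mult_left_mono) auto
    then have "(1 + \<delta>) * (2 / (1 - 2 * \<epsilon> n)\<^sup>2) * ln (real n) \<le> (real n - 1) * p n"
      using elim(1) by linarith
    then have "1 - 4 * real n powr (- 1) - real n powr (- (\<delta> / 2))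
        \<le> measure_pmf.prob (z2_sync n (p n) (\<epsilon> n) (z n)) {Y. exact_recovery n (z n) Y}"
      using par_n elim \<delta> by (intro recovery_probability_above_threshold) auto
    moreover have "4 * real n powr (- 1) + real n powr (- (\<delta> / 2)) \<le> real n powr (- \<kappa>)"
    proof -
      have "real n powr (- 1) \<le> real n powr (- 1 / 2) * real n powr (- \<kappa>)"
        unfolding powr_add[symmetric] using \<kappa> elim(4) by (intro powr_mono) auto
      moreover have "real n powr (- (\<delta> / 2)) \<le> real n powr (- (\<delta> / 4)) * real n powr (- \<kappa>)"
        unfolding powr_add[symmetric] using \<kappa> elim(4) by (intro powr_mono) auto
      ultimately have "4 * real n powr (- 1) + real n powr (- (\<delta> / 2))
          \<le> (4 * real n powr (- 1 / 2) + real n powr (- (\<delta> / 4))) * real n powr (- \<kappa>)"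
        by (simp add: algebra_simps)
      also have "\<dots> \<le> 1 * real n powr (- \<kappa>)" using elim(3) by (intro mult_right_mono) auto
      finally show ?thesis by simp
    qed
    ultimately show ?case by linarith
  qed
  then show "with_high_probability (\<lambda>n. z2_sync n (p n) (\<epsilon> n) (z n))
      (\<lambda>n. {Y. exact_recovery n (z n) Y})"
    unfolding with_high_probability_def using \<kappa>(1) by blast
qed

end
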